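(* Let $r\in (0,1]$, $p\in [1,\infty )$ and $q\in [r,\infty )$. Then $$W\!L^{1,r}(\mathbf R^d) * W\!L^{p,q}(\mathbf R^d) = W\!L^{p,q}(\mathbf R^d).$$
   Context: For $p,q\in(0,\infty]$, the Wiener amalgam space $W\!L^{p,q}(\mathbf R^d)$ consists of all Lebesgue measurable functions $f$ on $\mathbf R^d$ (modulo a.e. equality) such that $$\|f\|_{W\!L^{p,q}}\equiv \|a_f\|_{\ell^q(\mathbf Z^d)}<\infty ,\qquad a_f(k)=\|f\|_{L^p(k+Q)},\ k\in\mathbf Z^d,\ Q=[0,1]^d.$$ The symbol $*$ is convolution, $(f*g)(x)=\int_{\mathbf R^d} f(x-y)g(y)\,dy$. For two sets $E,F$ of functions, $E*F=\{f*g : f\in E,\ g\in F\}$ (the set of single products, not linear combinations). *)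

theory Defs
  imports "HOL-Analysis.Analysis" "HOL-Probability.Essential_Supremum"
begin

text \<open>Only used with positive exponents, whence the value at \<open>\<infinity>\<close>.\<close>

definition ennpowr :: "ennreal \<Rightarrow> real \<Rightarrow> ennreal" where
  "ennpowr x a = (if x = \<infinity> then \<infinity> else ennreal (enn2real x powr a))"

text \<open>The Lebesgue (quasi-)norm with exponent \<open>p\<close> in \<open>(0,\<infinity>]\<close> of an \<open>ennreal\<close>-valued function on
  an arbitrary measure space. With counting measure it is the sequence (quasi-)norm.\<close>

definition Lp_norm :: "ennreal \<Rightarrow> 'a measure \<Rightarrow> ('a \<Rightarrow> ennreal) \<Rightarrow> ennreal" where
  "Lp_norm p M u =
     (if p = \<infinity> then esssup M u
      else ennpowr (\<integral>\<^sup>+ x. ennpowr (u x) (enn2real p) \<partial>M) (1 / enn2real p))"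

definition unit_cube_at :: "int ^ 'n \<Rightarrow> (real ^ 'n) set" where
  "unit_cube_at k = (+) (\<chi> i. real_of_int (k $ i)) ` cbox 0 1"

definition local_norms :: "ennreal \<Rightarrow> (real ^ 'n \<Rightarrow> complex) \<Rightarrow> int ^ 'n \<Rightarrow> ennreal" where
  "local_norms p f k = Lp_norm p (lebesgue_on (unit_cube_at k)) (\<lambda>x. ennreal (norm (f x)))"

definition WL_norm :: "ennreal \<Rightarrow> ennreal \<Rightarrow> (real ^ 'n \<Rightarrow> complex) \<Rightarrow> ennreal" where
  "WL_norm p q f = Lp_norm q (count_space UNIV) (local_norms p f)"

definition ae_eq :: "((real ^ 'n \<Rightarrow> complex) \<times> (real ^ 'n \<Rightarrow> complex)) set" where
  "ae_eq = {(f, g). f \<in> borel_measurable lebesgue \<and> g \<in> borel_measurable lebesgue \<and>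
                    (AE x in lebesgue. f x = g x)}"

lemma equiv_ae_eq: "equiv (borel_measurable lebesgue) ae_eq"
  by (auto simp: equiv_def refl_on_def sym_def trans_def ae_eq_def)

text \<open>The elements of the Wiener amalgam space are equivalence classes of functions.\<close>

definition WL :: "ennreal \<Rightarrow> ennreal \<Rightarrow> (real ^ 'n \<Rightarrow> complex) set set" where
  "WL p q = {f \<in> borel_measurable lebesgue. WL_norm p q f < \<infinity>} // ae_eq"

text \<open>By the convention for Bochner integrals, the value is \<open>0\<close> wherever the integrand is
  not integrable.\<close>

definition conv :: "(real ^ 'n \<Rightarrow> complex) \<Rightarrow> (real ^ 'n \<Rightarrow> complex) \<Rightarrow> real ^ 'n \<Rightarrow> complex" where
  "conv f g x = (\<integral>y. f (x - y) * g y \<partial>lebesgue)"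

definition conv_exists :: "(real ^ 'n \<Rightarrow> complex) \<Rightarrow> (real ^ 'n \<Rightarrow> complex) \<Rightarrow> bool" where
  "conv_exists f g \<longleftrightarrow> (AE x in lebesgue. integrable lebesgue (\<lambda>y. f (x - y) * g y))"

text \<open>The classes of the single products \<open>f * g\<close>; \<open>f\<close> and \<open>g\<close> run through
  all representatives of the classes in \<open>E\<close> and \<open>F\<close>.\<close>

definition conv_set ::
  "(real ^ 'n \<Rightarrow> complex) set set \<Rightarrow> (real ^ 'n \<Rightarrow> complex) set set \<Rightarrow> (real ^ 'n \<Rightarrow> complex) set set"
where
  "conv_set E F = {ae_eq `` {conv f g} | f g. f \<in> \<Union>E \<and> g \<in> \<Union>F}"

end

theory Submission
  imports Defs
begin

text \<open>
  With \<open>s = min 1 q\<close>, the \<open>s\<close>-th power \<open>\<rho>\<close> of the norm of \<open>W L\<^sup>p\<^sup>,\<^sup>q\<close> is countably subadditive,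
  and \<open>\<rho> (f * g) \<le> K \<parallel>f\<parallel>\<^sub>1 powr s \<rho> g\<close> if \<open>f\<close> lives on the unit cube. Cutting \<open>f\<close> along the integer cubes,
  translating each piece to the unit cube and using \<open>r \<le> s\<close> gives the convolution inequality.

  For the converse, a variant of Cohen's factorization uses that all convolution operators commute.
  Fix \<open>a > 0\<close> small in terms of \<open>K\<close>. For a probability density \<open>e\<close> on the unit cube the operator
  \<open>(1 - a) + a e *\<close> is invertible by a Neumann series.
  Starting from \<open>g\<^sub>0 = h\<close> and \<open>F\<^sub>0 = 0\<close>, solve \<open>(1 - a) g\<^sub>n\<^sub>+\<^sub>1 + a e\<^sub>n * g\<^sub>n\<^sub>+\<^sub>1 = g\<^sub>n\<close> and multiply out the product of
  the measures \<open>(1 - a) \<delta> + a e\<^sub>n\<close> as \<open>(1 - a) ^ n \<delta> + F\<^sub>n\<close>, so that \<open>(1 - a) ^ n g\<^sub>n + F\<^sub>n * g\<^sub>n = h\<close>.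
  If the \<open>e\<^sub>n\<close> concentrate at \<open>0\<close> fast enough, then \<open>F\<^sub>n\<close> converges in \<open>L\<^sup>1\<close>, inside the unit cube, to
  some \<open>f\<close>, and \<open>g\<^sub>n\<close> converges to some \<open>g\<close>; the point mass disappears and \<open>f * g = h\<close>.
\<close>

section \<open>Powers and Minkowski's inequality on \<open>ennreal\<close>\<close>

text \<open>The obstacle is \<open>q < 1\<close>. The space is then only quasi-normed, and the L1
  norm of a kernel with spread-out support does not control convolution by it. So every kernel of
  the factorization has to stay in one fixed cube, where a constant \<open>K\<close> depending only
  on the dimension serves. The price is that convolution by a probability density is bounded by
  \<open>K\<close> instead of 1 in terms of \<open>\<rho>\<close>; hence \<open>a\<close> must be so
  small that the Neumann series converges however concentrated the density is.

  Commutativity lets the inverse of each new factor act on \<open>g\<^sub>n\<close> directly. The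
  density \<open>e\<^sub>n\<close> is chosen when \<open>F\<^sub>n\<close> and
  \<open>g\<^sub>n\<close> are already known, so as to move both very little, and no bound for the
  product of the earlier inverses is needed.

  Finiteness of \<open>p\<close> and \<open>q\<close> enters through dominated convergence, which
  makes approximate identities converge on the whole space. The condition \<open>p \<ge> 1\<close>
  enters through Jensen's inequality, which is behind both Minkowski's inequality and the local
  convolution estimate.\<close>

lemma ennpowr_ennreal: "0 \<le> x \<Longrightarrow> ennpowr (ennreal x) a = ennreal (x powr a)"
  by (simp add: ennpowr_def)

lemma ennpowr_top [simp]: "ennpowr top a = top"
  by (simp add: ennpowr_def)

lemma ennpowr_0 [simp]: "ennpowr 0 a = 0"
  by (simp add: ennpowr_def)

lemma ennpowr_1 [simp]: "ennpowr 1 a = 1"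
  using ennpowr_ennreal[of 1 a] by simp

lemma ennpowr_exponent_1 [simp]: "ennpowr x 1 = x"
  by (cases x) (auto simp: ennpowr_ennreal)

lemma ennpowr_mono: "0 \<le> a \<Longrightarrow> x \<le> y \<Longrightarrow> ennpowr x a \<le> ennpowr y a"
  by (cases x; cases y) (auto simp: ennpowr_ennreal powr_mono2 ennreal_leI top_unique)

lemma ennpowr_ennpowr [simp]: "ennpowr (ennpowr x a) b = ennpowr x (a * b)"
  by (cases x) (auto simp: ennpowr_ennreal powr_powr)

lemma ennpowr_mult: "ennpowr (x * y) a = ennpowr x a * ennpowr y a"
proof (cases "x = 0 \<or> y = 0")
  case False
  then show ?thesis
    by (cases x; cases y)
       (auto simp: ennpowr_ennreal ennreal_mult[symmetric] powr_mult ennreal_mult_eq_top_iff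
         ennreal_top_mult ennreal_mult_top)
qed auto

lemma ennpowr_eq_0_iff [simp]: "ennpowr x a = 0 \<longleftrightarrow> x = 0"
  by (cases x) (auto simp: ennpowr_ennreal)

lemma ennpowr_less_top_iff [simp]: "ennpowr x a < top \<longleftrightarrow> x < top"
  by (cases x) (auto simp: ennpowr_ennreal)

text \<open>A monotone map with open range is continuous; here the range is everything, since the
  exponent \<open>1 / a\<close> gives an inverse.\<close>

lemma continuous_ennpowr:
  assumes "0 < a" shows "continuous_on UNIV (\<lambda>x. ennpowr x a)"
proof (rule continuous_onI_mono)
  have "ennpowr (ennpowr y (1 / a)) a = y" for y
    using assms by simp
  then have "range (\<lambda>x. ennpowr x a) = UNIV"
    by (metis surjI)
  then show "open (range (\<lambda>x. ennpowr x a))" by simp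
qed (use assms ennpowr_mono in auto)

lemma tendsto_ennpowr [tendsto_intros]:
  "0 < a \<Longrightarrow> (f \<longlongrightarrow> l) F \<Longrightarrow> ((\<lambda>x. ennpowr (f x) a) \<longlongrightarrow> ennpowr l a) F"
  by (rule continuous_on_tendsto_compose[OF continuous_ennpowr]) auto

lemma borel_measurable_ennpowr [measurable (raw)]:
  assumes [measurable]: "f \<in> borel_measurable M"
  shows "(\<lambda>x. ennpowr (f x) a) \<in> borel_measurable M"
  unfolding ennpowr_def by measurable

text \<open>Each of the fractions \<open>x / (x + y)\<close> and \<open>y / (x + y)\<close> is at
  most its own power with exponent \<open>a\<close>, and they add up to 1. Multiply by
  \<open>(x + y) powr a\<close>.\<close>

lemma ennpowr_add_le:
  assumes "0 < a" "a \<le> 1" shows "ennpowr (x + y) a \<le> ennpowr x a + ennpowr y a"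
proof -
  have "(s + t) powr a \<le> s powr a + t powr a" if "0 < s" "0 < t" for s t :: real
  proof -
    have *: "r / (s + t) * (s + t) powr a \<le> r powr a" if "0 < r" "r < s + t" for r
    proof -
      have "r / (s + t) \<le> (r / (s + t)) powr a"
        using powr_mono'[of a 1 "r / (s + t)"] assms that by auto
      then show ?thesis using that
        by (simp add: powr_divide field_simps)
    qed
    have "(s + t) powr a = s / (s + t) * (s + t) powr a + t / (s + t) * (s + t) powr a"
      using that by (simp flip: distrib_right add_divide_distrib)
    also have "\<dots> \<le> s powr a + t powr a"
      using that by (intro add_mono *) auto
    finally show ?thesis .
  qed
  then have "(s + t) powr a \<le> s powr a + t powr a" if "0 \<le> s" "0 \<le> t" for s t :: real
    using that assms by (cases "s = 0"; cases "t = 0") auto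
  then show ?thesis
    by (cases x; cases y) (auto simp: ennpowr_ennreal simp flip: ennreal_plus intro!: ennreal_leI)
qed

lemma ennpowr_sum_le:
  assumes "0 < a" "a \<le> 1" "finite I"
  shows "ennpowr (\<Sum>i\<in>I. x i) a \<le> (\<Sum>i\<in>I. ennpowr (x i) a)"
  using assms(3)
proof induction
  case (insert i I)
  then show ?case
    using ennpowr_add_le[OF assms(1,2), of "x i" "sum x I"]
    by (simp add: order.trans[OF _ add_left_mono])
qed auto

lemma ennpowr_suminf_le:
  assumes "0 < a" "a \<le> 1"
  shows "ennpowr (\<Sum>i. x i) a \<le> (\<Sum>i. ennpowr (x i) a)"
proof (rule LIMSEQ_le_const2)
  have "(\<lambda>n. \<Sum>i<n. x i) \<longlonglongrightarrow> (\<Sum>i. x i)"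
    by (rule summable_LIMSEQ) auto
  then show "(\<lambda>n. ennpowr (\<Sum>i<n. x i) a) \<longlonglongrightarrow> ennpowr (\<Sum>i. x i) a"
    by (intro tendsto_intros assms)
  show "\<exists>N. \<forall>n\<ge>N. ennpowr (\<Sum>i<n. x i) a \<le> (\<Sum>i. ennpowr (x i) a)"
    using order.trans[OF ennpowr_sum_le[OF assms] sum_le_suminf] by (metis finite_lessThan summableI zero_le)
qed

text \<open>The power function lies above its tangent at the mean \<open>m\<close> of
  \<open>u\<close>. Integrating the tangent inequality against the probability density
  \<open>w\<close> leaves \<open>m powr p\<close>.\<close>

lemma ennpowr_Jensen:
  assumes [measurable]: "w \<in> borel_measurable M" "u \<in> borel_measurable M"
    and w: "(\<integral>\<^sup>+x. w x \<partial>M) = 1" and p: "1 \<le> p"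
  shows "ennpowr (\<integral>\<^sup>+x. w x * u x \<partial>M) p \<le> (\<integral>\<^sup>+x. w x * ennpowr (u x) p \<partial>M)"
proof (cases "(\<integral>\<^sup>+x. w x * ennpowr (u x) p \<partial>M)")
  case (real I)
  \<comment> \<open>This makes the mean finite, so that there is a tangent at it.\<close>
  have "x \<le> 1 + ennpowr x p" for x
  proof (cases "x \<le> 1")
    case False
    then show ?thesis using p
      using powr_mono[of 1 p "enn2real x"] by (cases x) (auto simp: ennpowr_ennreal intro!: add_increasing ennreal_leI)
  qed (simp add: add_increasing2)
  then have "(\<integral>\<^sup>+x. w x * u x \<partial>M) \<le> (\<integral>\<^sup>+x. w x + w x * ennpowr (u x) p \<partial>M)"
    by (intro nn_integral_mono) (metis distrib_left mult.right_neutral mult_left_mono zero_le)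
  also have "\<dots> = 1 + I"
    by (simp add: nn_integral_add w real)
  also have "\<dots> < top"
    by simp
  finally obtain m where m: "(\<integral>\<^sup>+x. w x * u x \<partial>M) = ennreal m" "0 \<le> m"
    by (cases "\<integral>\<^sup>+x. w x * u x \<partial>M") auto
  \<comment> \<open>The tangent inequality is Young's inequality for \<open>t powr p\<close> and
    \<open>m powr p\<close> with the weights \<open>1 / p\<close> and
    \<open>1 - 1 / p\<close>.\<close>
  have real_ineq: "p * m powr (p - 1) * t \<le> t powr p + (p - 1) * m powr p" if t: "0 \<le> t" for t
  proof (cases "t = 0 \<or> m = 0")
    case False
    then have "0 < t" "0 < m" using m t by auto
    then have "t * m powr (p - 1) \<le> 1 / p * t powr p + (1 - 1 / p) * m powr p"
      using Youngs_inequality_0[of "1 / p" "1 - 1 / p" "t powr p" "m powr p"] p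
      by (simp add: powr_powr algebra_simps)
    then have "p * (t * m powr (p - 1)) \<le> p * (1 / p * t powr p + (1 - 1 / p) * m powr p)"
      using p by (intro mult_left_mono) auto
    also have "\<dots> = t powr p + (p - 1) * m powr p"
      using p by (simp add: field_simps)
    finally show ?thesis by (simp add: ac_simps)
  qed (use p in auto)
  have ineq: "ennreal (p * m powr (p - 1)) * t \<le> ennpowr t p + ennreal ((p - 1) * m powr p)" for t
    using p by (cases t) (auto simp: ennpowr_ennreal simp flip: ennreal_mult' ennreal_plus
        intro!: ennreal_leI real_ineq)
  have "ennreal (p * m powr (p - 1)) * (\<integral>\<^sup>+x. w x * u x \<partial>M)
      = (\<integral>\<^sup>+x. w x * (ennreal (p * m powr (p - 1)) * u x) \<partial>M)"
    by (simp add: nn_integral_cmult[symmetric] ac_simps)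
  also have "\<dots> \<le> (\<integral>\<^sup>+x. w x * (ennpowr (u x) p + ennreal ((p - 1) * m powr p)) \<partial>M)"
    by (intro nn_integral_mono mult_left_mono ineq) auto
  also have "\<dots> = I + ennreal ((p - 1) * m powr p)"
    by (simp add: distrib_left nn_integral_add nn_integral_multc w real)
  finally have "ennreal (p * m powr (p - 1) * m) \<le> ennreal (I + (p - 1) * m powr p)"
    using p m real by (simp add: ennreal_mult')
  then have "p * m powr (p - 1) * m \<le> I + (p - 1) * m powr p"
    using p m real by (subst (asm) ennreal_le_iff) auto
  moreover have "p * m powr (p - 1) * m = p * m powr p"
    using m by (cases "m = 0") (auto simp: powr_mult_base mult.commute)
  ultimately have "m powr p \<le> I"
    by (simp only: left_diff_distrib)
  then show ?thesis
    using m real by (simp add: ennpowr_ennreal ennreal_leI)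
qed simp

section \<open>Minkowski's inequality and dominated convergence for finite exponents\<close>

definition nrm :: "real \<Rightarrow> 'a measure \<Rightarrow> ('a \<Rightarrow> ennreal) \<Rightarrow> ennreal" where
  "nrm p M u = ennpowr (\<integral>\<^sup>+x. ennpowr (u x) p \<partial>M) (1 / p)"

lemma nrm_mono_AE:
  "0 < p \<Longrightarrow> (AE x in M. u x \<le> v x) \<Longrightarrow> nrm p M u \<le> nrm p M v"
  unfolding nrm_def
  by (intro ennpowr_mono nn_integral_mono_AE) (auto elim!: eventually_mono intro: ennpowr_mono)

lemma nrm_cmult:
  assumes "0 < p" and [measurable]: "u \<in> borel_measurable M"
  shows "nrm p M (\<lambda>x. c * u x) = c * nrm p M u"
  using assms by (simp add: nrm_def ennpowr_mult nn_integral_cmult)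

lemma nrm_eq_0:
  assumes "0 < p" and [measurable]: "u \<in> borel_measurable M" "nrm p M u = 0"
  shows "AE x in M. u x = 0"
  using assms by (simp add: nrm_def nn_integral_0_iff_AE)

lemma ennpowr_nrm: "0 < p \<Longrightarrow> ennpowr (nrm p M u) p = (\<integral>\<^sup>+x. ennpowr (u x) p \<partial>M)"
  by (simp add: nrm_def)

text \<open>With the weights \<open>w n / W\<close> the sum is a convex combination of the functions
  \<open>W / w n * u n\<close>, each of norm at most \<open>W\<close>. Jensen's inequality over the
  index set bounds its \<open>p\<close>-th power pointwise.\<close>

lemma nrm_suminf_le:
  assumes p: "1 \<le> p" and [measurable]: "\<And>n. u n \<in> borel_measurable M"
  shows "nrm p M (\<lambda>x. \<Sum>n. u n x) \<le> (\<Sum>n. nrm p M (u n))"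
proof (rule ennreal_le_epsilon)
  fix e :: real assume fin: "(\<Sum>n. nrm p M (u n)) < top" and e: "0 < e"
  \<comment> \<open>The geometric term keeps every weight positive, so that division by
    \<open>w n\<close> makes sense even if \<open>u n\<close> has norm 0. In total it costs
    \<open>e\<close>.\<close>
  define w where "w n = nrm p M (u n) + ennreal (e * (1/2) ^ Suc n)" for n
  define W where "W = (\<Sum>n. w n)"
  have "(\<lambda>n. ennreal (e * (1/2) ^ Suc n)) sums ennreal (e * 1)"
    using e power_half_series by (intro sums_ennreal[THEN iffD2] sums_mult) auto
  then have W: "W = (\<Sum>n. nrm p M (u n)) + e"
    unfolding W_def w_def by (subst suminf_add[symmetric]) (auto simp: sums_iff)
  have W_fin: "W < top" using fin W by simp
  have w0: "w n > 0" for n using e by (simp add: w_def add_nonneg_pos)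
  have w_le: "w n \<le> W" for n
    unfolding W_def using sum_le_suminf[of w "{n}"] by simp
  have w_fin: "w n < top" for n using w_le W_fin by (rule le_less_trans)
  have W0: "W > 0" using w0 w_le[of 0] by (rule less_le_trans)
  have canc: "w n / W * (W / w n * x) = x" for n x
    using w0[of n] w_fin[of n] W0 W_fin
    by (cases "w n"; cases W; cases x)
       (auto simp: divide_ennreal ennreal_mult[symmetric] ennreal_mult_top)
  have pointwise: "ennpowr (\<Sum>n. u n x) p \<le> (\<Sum>n. w n / W * ennpowr (W / w n * u n x) p)" for x
  proof -
    have "(\<Sum>n. w n / W) = 1"
      using W0 W_fin by (simp flip: W_def add: ennreal_divide_self)
    then have "ennpowr (\<integral>\<^sup>+n. w n / W * (W / w n * u n x) \<partial>count_space UNIV) p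
       \<le> (\<integral>\<^sup>+n. w n / W * ennpowr (W / w n * u n x) p \<partial>count_space UNIV)"
      using p by (intro ennpowr_Jensen) (auto simp: nn_integral_count_space_nat)
    then show ?thesis
      unfolding canc by (simp add: nn_integral_count_space_nat)
  qed
  have "(\<integral>\<^sup>+x. ennpowr (\<Sum>n. u n x) p \<partial>M) \<le> (\<integral>\<^sup>+x. (\<Sum>n. w n / W * ennpowr (W / w n * u n x) p) \<partial>M)"
    by (intro nn_integral_mono pointwise)
  also have "\<dots> = (\<Sum>n. w n / W * (ennpowr (W / w n) p * ennpowr (nrm p M (u n)) p))"
    using p by (simp add: nn_integral_suminf nn_integral_cmult ennpowr_mult ennpowr_nrm)
  also have "\<dots> \<le> (\<Sum>n. w n / W * ennpowr W p)"
  proof (intro suminf_le mult_left_mono)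
    fix n
    have "W / w n * nrm p M (u n) \<le> W / w n * w n"
      by (intro mult_left_mono) (auto simp: w_def)
    also have "\<dots> = W"
      using w0[of n] w_fin[of n] by (cases "w n"; cases W) (auto simp: divide_ennreal ennreal_mult[symmetric] ennreal_top_divide ennreal_top_mult)
    finally show "ennpowr (W / w n) p * ennpowr (nrm p M (u n)) p \<le> ennpowr W p"
      using p by (simp flip: ennpowr_mult add: ennpowr_mono)
  qed auto
  also have "\<dots> = ennpowr W p"
    using W0 W_fin by (simp flip: W_def add: ennreal_divide_self)
  finally have "nrm p M (\<lambda>x. \<Sum>n. u n x) \<le> ennpowr (ennpowr W p) (1 / p)"
    unfolding nrm_def using p by (intro ennpowr_mono) auto
  then show "nrm p M (\<lambda>x. \<Sum>n. u n x) \<le> (\<Sum>n. nrm p M (u n)) + e"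
    using p W by simp
qed

text \<open>This is the origin of the power \<open>min 1 q\<close>. For \<open>q < 1\<close> the
  \<open>q\<close>-th power of the quasi-norm is an integral whose integrand is subadditive
  pointwise; for \<open>q \<ge> 1\<close> Minkowski's inequality applies to the norm itself.\<close>

lemma ennpowr_nrm_suminf_le:
  assumes q: "0 < q" and [measurable]: "\<And>n. u n \<in> borel_measurable M"
  shows "ennpowr (nrm q M (\<lambda>x. \<Sum>n. u n x)) (min 1 q) \<le> (\<Sum>n. ennpowr (nrm q M (u n)) (min 1 q))"
proof (cases "1 \<le> q")
  case True
  then show ?thesis using nrm_suminf_le[OF True, of u M] by (simp add: min_absorb1)
next
  case False
  have "(\<integral>\<^sup>+x. ennpowr (\<Sum>n. u n x) q \<partial>M) \<le> (\<integral>\<^sup>+x. (\<Sum>n. ennpowr (u n x) q) \<partial>M)"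
    using False q by (intro nn_integral_mono ennpowr_suminf_le) auto
  then show ?thesis using False q
    by (simp add: min_absorb2 ennpowr_nrm nn_integral_suminf)
qed

lemma tendsto_nrm_0:
  assumes p: "0 < p" and [measurable]: "\<And>n. u n \<in> borel_measurable M" "v \<in> borel_measurable M"
    and "AE x in M. (\<lambda>n. u n x) \<longlonglongrightarrow> 0" "\<And>n. AE x in M. u n x \<le> v x" "nrm p M v < top"
  shows "(\<lambda>n. nrm p M (u n)) \<longlonglongrightarrow> 0"
proof -
  have "(\<lambda>n. \<integral>\<^sup>+x. ennpowr (u n x) p \<partial>M) \<longlonglongrightarrow> (\<integral>\<^sup>+x. 0 \<partial>M)"
  proof (rule nn_integral_dominated_convergence[where w="\<lambda>x. ennpowr (v x) p"])
    show "AE x in M. ennpowr (u n x) p \<le> ennpowr (v x) p" for n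
      using assms(5)[of n] p by (auto elim!: eventually_mono intro: ennpowr_mono)
    show "(\<integral>\<^sup>+x. ennpowr (v x) p \<partial>M) < \<infinity>"
      using assms(6) by (simp add: nrm_def)
    show "AE x in M. (\<lambda>n. ennpowr (u n x) p) \<longlonglongrightarrow> 0"
      using assms(4) by (rule eventually_mono) (use tendsto_ennpowr[OF p] in fastforce)
  qed auto
  then show ?thesis
    using tendsto_ennpowr[of "1/p" _ 0] p by (simp add: nrm_def)
qed

section \<open>Convolution of Borel functions\<close>

lemma distr_lborel_minus: "distr lborel borel (\<lambda>y. x - y) = (lborel :: 'a::euclidean_space measure)"
  using lborel_affine[of "-1" x] by (simp add: density_1)

lemma distr_lborel_diff: "distr lborel borel (\<lambda>y. y - x) = (lborel :: 'a::euclidean_space measure)"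
  using lborel_distr_plus[of "- x"] by (simp add: uminus_add_conv_diff cong: distr_cong)

lemma nn_integral_lborel_minus:
  fixes x :: "'a::euclidean_space"
  assumes [measurable]: "f \<in> borel_measurable borel"
  shows "(\<integral>\<^sup>+y. f (x - y) \<partial>lborel) = (\<integral>\<^sup>+y. f y \<partial>lborel)"
  by (subst (2) distr_lborel_minus[of x, symmetric]) (simp add: nn_integral_distr)

lemma nn_integral_lborel_diff:
  fixes x :: "'a::euclidean_space"
  assumes [measurable]: "f \<in> borel_measurable borel"
  shows "(\<integral>\<^sup>+y. f (y - x) \<partial>lborel) = (\<integral>\<^sup>+y. f y \<partial>lborel)"
  by (subst (2) distr_lborel_diff[of x, symmetric]) (simp add: nn_integral_distr)

lemma integral_lborel_minus:
  fixes x :: "'a::euclidean_space" and f :: "'a \<Rightarrow> complex"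
  assumes [measurable]: "f \<in> borel_measurable borel"
  shows "(\<integral>y. f (x - y) \<partial>lborel) = (\<integral>y. f y \<partial>lborel)"
  by (subst (2) distr_lborel_minus[of x, symmetric]) (simp add: integral_distr)

lemma integral_lborel_diff:
  fixes x :: "'a::euclidean_space" and f :: "'a \<Rightarrow> complex"
  assumes [measurable]: "f \<in> borel_measurable borel"
  shows "(\<integral>y. f (y - x) \<partial>lborel) = (\<integral>y. f y \<partial>lborel)"
  by (subst (2) distr_lborel_diff[of x, symmetric]) (simp add: integral_distr)

lemma AE_lborel_minus:
  fixes x :: "'a::euclidean_space"
  assumes "AE y in lborel. P y" shows "AE y in lborel. P (x - y)"
proof -
  from AE_E[OF assms] obtain N where N: "{y \<in> space lborel. \<not> P y} \<subseteq> N" "emeasure lborel N = 0" "N \<in> sets lborel"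
    by blast
  have "AE y in distr lborel borel (\<lambda>y. x - y). y \<notin> N"
    unfolding distr_lborel_minus using N by (intro AE_not_in) auto
  then have "AE y in lborel. x - y \<notin> N"
    using N by (subst (asm) AE_distr_iff) auto
  then show ?thesis by eventually_elim (use N in auto)
qed

abbreviation enorm :: "('a \<Rightarrow> complex) \<Rightarrow> 'a \<Rightarrow> ennreal" where
  "enorm f \<equiv> \<lambda>x. ennreal (norm (f x))"

text \<open>The nonnegative version has a value everywhere and carries Tonelli's theorem and the
  norm estimates. Where \<open>nconv (enorm f) (enorm g)\<close> is finite, the integrand of
  \<open>cconv\<close> is integrable.\<close>

definition nconv :: "('a::euclidean_space \<Rightarrow> ennreal) \<Rightarrow> ('a \<Rightarrow> ennreal) \<Rightarrow> 'a \<Rightarrow> ennreal" where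
  "nconv u v x = (\<integral>\<^sup>+y. u (x - y) * v y \<partial>lborel)"

text \<open>This is \<open>conv\<close> for Borel representatives and \<open>lborel\<close>: for
  Borel functions \<open>f (x - y) * g y\<close> is jointly measurable for the product measure, as
  Fubini's theorem requires.\<close>

definition cconv :: "('a::euclidean_space \<Rightarrow> complex) \<Rightarrow> ('a \<Rightarrow> complex) \<Rightarrow> 'a \<Rightarrow> complex" where
  "cconv f g x = (\<integral>y. f (x - y) * g y \<partial>lborel)"

lemma borel_measurable_nconv [measurable]:
  assumes [measurable]: "u \<in> borel_measurable borel" "v \<in> borel_measurable borel"
  shows "nconv u v \<in> borel_measurable borel"
  unfolding nconv_def[abs_def] by measurable

lemma borel_measurable_cconv [measurable]:
  assumes [measurable]: "f \<in> borel_measurable borel" "g \<in> borel_measurable borel"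
  shows "cconv f g \<in> borel_measurable borel"
  unfolding cconv_def[abs_def] by measurable

lemma nconv_commute:
  assumes [measurable]: "u \<in> borel_measurable borel" "v \<in> borel_measurable borel"
  shows "nconv u v = nconv v u"
proof
  show "nconv u v x = nconv v u x" for x
    unfolding nconv_def by (subst nn_integral_lborel_minus[of _ x, symmetric]) (auto simp: mult.commute)
qed

lemma cconv_commute:
  assumes [measurable]: "f \<in> borel_measurable borel" "g \<in> borel_measurable borel"
  shows "cconv f g = cconv g f"
proof
  show "cconv f g x = cconv g f x" for x
    unfolding cconv_def by (subst integral_lborel_minus[of _ x, symmetric]) (auto simp: mult.commute)
qed

lemma nn_integral_nconv:
  assumes [measurable]: "u \<in> borel_measurable borel" "v \<in> borel_measurable borel"
  shows "(\<integral>\<^sup>+x. nconv u v x \<partial>lborel) = (\<integral>\<^sup>+x. u x \<partial>lborel) * (\<integral>\<^sup>+x. v x \<partial>lborel)"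
proof -
  have "(\<integral>\<^sup>+x. nconv u v x \<partial>lborel) = (\<integral>\<^sup>+y. \<integral>\<^sup>+x. u (x - y) * v y \<partial>lborel \<partial>lborel)"
    unfolding nconv_def by (rule lborel_pair.Fubini') simp
  also have "\<dots> = (\<integral>\<^sup>+y. (\<integral>\<^sup>+x. u x \<partial>lborel) * v y \<partial>lborel)"
    by (simp add: nn_integral_multc nn_integral_lborel_diff)
  finally show ?thesis by (simp add: nn_integral_cmult)
qed

lemma nconv_suminf_left:
  assumes [measurable]: "\<And>n. u n \<in> borel_measurable borel" "v \<in> borel_measurable borel"
  shows "nconv (\<lambda>x. \<Sum>n. u n x) v x = (\<Sum>n. nconv (u n) v x)"
  by (simp add: nconv_def nn_integral_suminf flip: ennreal_suminf_multc)

lemma nconv_mono: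
  "(\<And>x. u x \<le> u' x) \<Longrightarrow> (\<And>x. v x \<le> v' x) \<Longrightarrow> nconv u v x \<le> nconv u' v' x"
  unfolding nconv_def by (intro nn_integral_mono mult_mono) auto

text \<open>No integrability is assumed, because where the integral diverges the left side is 0 by
  convention. Norm bounds for \<open>cconv\<close> are thus available before its existence is
  settled.\<close>

lemma enorm_cconv_le:
  "ennreal (norm (cconv f g x)) \<le> nconv (enorm f) (enorm g) x"
proof (cases "integrable lborel (\<lambda>y. f (x - y) * g y)")
  case True
  then show ?thesis
    using integral_norm_bound_ennreal[OF True] by (simp add: cconv_def nconv_def norm_mult ennreal_mult)
qed (simp add: cconv_def not_integrable_integral_eq)

lemma integrable_cconv:
  assumes [measurable]: "f \<in> borel_measurable borel" "g \<in> borel_measurable borel"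
    and "nconv (enorm f) (enorm g) x < top"
  shows "integrable lborel (\<lambda>y. f (x - y) * g y)"
  using assms(3) by (simp add: integrable_iff_bounded nconv_def norm_mult ennreal_mult)

lemma cconv_add_right:
  assumes [measurable]: "f \<in> borel_measurable borel" "g \<in> borel_measurable borel" "h \<in> borel_measurable borel"
    and "nconv (enorm f) (enorm g) x < top" "nconv (enorm f) (enorm h) x < top"
  shows "cconv f (\<lambda>x. g x + h x) x = cconv f g x + cconv f h x"
  using assms by (simp add: cconv_def distrib_left integrable_cconv)

lemma cconv_add_left:
  assumes [measurable]: "f \<in> borel_measurable borel" "g \<in> borel_measurable borel" "h \<in> borel_measurable borel"
    and "nconv (enorm f) (enorm h) x < top" "nconv (enorm g) (enorm h) x < top"
  shows "cconv (\<lambda>x. f x + g x) h x = cconv f h x + cconv g h x"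
  using assms by (simp add: cconv_def distrib_right integrable_cconv)

lemma cconv_cmult_left: "cconv (\<lambda>x. c * f x) g x = c * cconv f g x"
  by (simp add: cconv_def mult.assoc)

lemma cconv_cmult_right: "cconv f (\<lambda>x. c * g x) x = c * cconv f g x"
  by (simp add: cconv_def mult.left_commute[of _ c])

lemma cconv_cong_AE_right:
  assumes [measurable]: "f \<in> borel_measurable borel" "g \<in> borel_measurable borel" "g' \<in> borel_measurable borel"
    and "AE x in lborel. g x = g' x"
  shows "cconv f g = cconv f g'"
  unfolding cconv_def fun_eq_iff using assms(4) by (intro allI integral_cong_AE) auto

text \<open>Fubini's theorem at the single point \<open>x\<close>: the hypothesis says exactly that
  the double integrand is absolutely integrable there.\<close>

lemma cconv_assoc:
  assumes [measurable]: "f \<in> borel_measurable borel" "g \<in> borel_measurable borel" "h \<in> borel_measurable borel"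
    and fin: "nconv (enorm f) (nconv (enorm g) (enorm h)) x < top"
  shows "cconv (cconv f g) h x = cconv f (cconv g h) x"
proof -
  define \<Phi> where "\<Phi> y z = f (x - y) * g (y - z) * h z" for y z
  have [measurable]: "case_prod \<Phi> \<in> borel_measurable (lborel \<Otimes>\<^sub>M lborel)"
    unfolding \<Phi>_def by measurable
  have "(\<integral>\<^sup>+p. ennreal (norm (case_prod \<Phi> p)) \<partial>(lborel \<Otimes>\<^sub>M lborel)) = (\<integral>\<^sup>+y. \<integral>\<^sup>+z. ennreal (norm (\<Phi> y z)) \<partial>lborel \<partial>lborel)"
    by (subst lborel.nn_integral_fst[symmetric]) auto
  also have "\<dots> = nconv (enorm f) (nconv (enorm g) (enorm h)) x"
    by (simp add: nconv_def \<Phi>_def norm_mult ennreal_mult mult.assoc nn_integral_cmult)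
  finally have int: "integrable (lborel \<Otimes>\<^sub>M lborel) (case_prod \<Phi>)"
    using fin by (simp add: integrable_iff_bounded)
  have inner: "(\<integral>y. \<Phi> y z \<partial>lborel) = cconv f g (x - z) * h z" for z
  proof -
    have "cconv f g (x - z) = (\<integral>y. f (x - z - (y - z)) * g (y - z) \<partial>lborel)"
      unfolding cconv_def by (rule integral_lborel_diff[symmetric]) measurable
    then show ?thesis
      by (simp add: \<Phi>_def)
  qed
  have "cconv (cconv f g) h x = (\<integral>z. \<integral>y. \<Phi> y z \<partial>lborel \<partial>lborel)"
    unfolding inner cconv_def[of "cconv f g"] ..
  also have "\<dots> = (\<integral>y. \<integral>z. \<Phi> y z \<partial>lborel \<partial>lborel)"
    by (rule lborel_pair.Fubini_integral[OF int])
  also have "\<dots> = cconv f (cconv g h) x"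
    by (simp add: cconv_def \<Phi>_def mult.assoc)
  finally show ?thesis .
qed

section \<open>Modules over \<open>L\<^sup>1\<close> functions on the unit cube\<close>

lemma tendsto_0_ennrealI:
  fixes f :: "'b \<Rightarrow> ennreal"
  assumes "\<And>e::real. 0 < e \<Longrightarrow> eventually (\<lambda>x. f x \<le> ennreal e) F"
  shows "(f \<longlongrightarrow> 0) F"
proof (rule order_tendstoI)
  fix a :: ennreal assume "0 < a"
  then obtain b where b: "0 < b" "b < a" using dense by blast
  then obtain e where "b = ennreal e" "0 < e"
    by (cases b) (auto simp: top_unique)
  then show "eventually (\<lambda>x. f x < a) F"
    using assms[of e] b by (auto elim!: eventually_mono)
qed simp

lemma tendsto_suminf_tail_0:
  fixes a :: "nat \<Rightarrow> ennreal"
  assumes "(\<Sum>j. a j) < top"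
  shows "(\<lambda>m. \<Sum>j. a (j + m)) \<longlonglongrightarrow> 0"
proof -
  have fin: "(\<Sum>j<m. a j) < top" for m
    by (rule le_less_trans[OF sum_le_suminf assms]) auto
  have "(\<Sum>j. a (j + m)) = (\<Sum>j. a j) - (\<Sum>j<m. a j)" for m
    using suminf_offset[of a m] ennreal_add_diff_cancel_right[OF less_imp_neq[OF fin[of m]], of "\<Sum>j. a (j + m)"]
    by (simp add: summableI)
  moreover have "(\<lambda>m. (\<Sum>j. a j) - (\<Sum>j<m. a j)) \<longlonglongrightarrow> (\<Sum>j. a j) - (\<Sum>j. a j)"
    using assms by (intro tendsto_diff_ennreal_general tendsto_const summable_LIMSEQ) auto
  ultimately show ?thesis using assms by simp
qed

text \<open>The interface has two instances: the L1 integral, which measures the kernels, and the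
  power \<open>rho\<close> of the amalgam quasi-norm, which measures the functions they act on.
  \<open>\<rho>\<close> is countably subadditive but homogeneous of degree \<open>s\<close>. The
  assumptions \<open>dominated\<close> and \<open>bounded\<close> are what the density of simple
  functions rests on. In \<open>nconv_le\<close> the kernels are confined to the unit cube, since
  only then can one \<open>K\<close> serve when \<open>q < 1\<close>.\<close>

locale conv_module =
  fixes \<rho> :: "('a::euclidean_space \<Rightarrow> ennreal) \<Rightarrow> ennreal" and s K :: real
  assumes s_pos: "0 < s" and K_ge: "1 \<le> K"
    and mono: "\<And>u v. u \<in> borel_measurable borel \<Longrightarrow> v \<in> borel_measurable borel \<Longrightarrow>
      (AE x in lborel. u x \<le> v x) \<Longrightarrow> \<rho> u \<le> \<rho> v"
    and suminf: "\<And>w. (\<And>n::nat. w n \<in> borel_measurable borel) \<Longrightarrow>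
      \<rho> (\<lambda>x. \<Sum>n. w n x) \<le> (\<Sum>n. \<rho> (w n))"
    and cmult: "\<And>u c. u \<in> borel_measurable borel \<Longrightarrow> \<rho> (\<lambda>x. c * u x) = ennpowr c s * \<rho> u"
    and eq_0: "\<And>u. u \<in> borel_measurable borel \<Longrightarrow> \<rho> u = 0 \<Longrightarrow> AE x in lborel. u x = 0"
    and dominated: "\<And>w v. (\<And>n::nat. w n \<in> borel_measurable borel) \<Longrightarrow> v \<in> borel_measurable borel \<Longrightarrow>
      (AE x in lborel. (\<lambda>n. w n x) \<longlonglongrightarrow> 0) \<Longrightarrow> (\<And>n. AE x in lborel. w n x \<le> v x) \<Longrightarrow>
      \<rho> v < top \<Longrightarrow> (\<lambda>n. \<rho> (w n)) \<longlonglongrightarrow> 0"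
    and bounded: "\<And>A. A \<in> sets borel \<Longrightarrow> bounded A \<Longrightarrow> \<rho> (indicator A) < top"
    and nconv_le: "\<And>u v. u \<in> borel_measurable borel \<Longrightarrow> v \<in> borel_measurable borel \<Longrightarrow>
      (\<And>x. x \<notin> cbox 0 One \<Longrightarrow> u x = 0) \<Longrightarrow> (\<integral>\<^sup>+x. u x \<partial>lborel) < top \<Longrightarrow>
      \<rho> (nconv u v) \<le> ennreal K * ennpowr (\<integral>\<^sup>+x. u x \<partial>lborel) s * \<rho> v"
begin

lemma rho_0 [simp]: "\<rho> (\<lambda>x. 0) = 0"
  using cmult[of "\<lambda>x. 0" 0] by simp

lemma rho_le_add:
  assumes [measurable]: "u \<in> borel_measurable borel" "v \<in> borel_measurable borel" "w \<in> borel_measurable borel"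
    and "AE x in lborel. w x \<le> u x + v x"
  shows "\<rho> w \<le> \<rho> u + \<rho> v"
proof -
  define f where "f n x = (if n = 0 then u x else if n = Suc 0 then v x else 0)" for n x
  have [measurable]: "f n \<in> borel_measurable borel" for n
    unfolding f_def[abs_def] by measurable
  have "(\<Sum>n. f n x) = (\<Sum>n\<in>{0, 1}. f n x)" for x
    by (rule suminf_finite) (auto simp: f_def)
  then have "(\<Sum>n. f n x) = u x + v x" for x
    by (simp add: f_def)
  moreover have "(\<Sum>n. \<rho> (f n)) = (\<Sum>n\<in>{0, 1}. \<rho> (f n))"
    by (rule suminf_finite) (auto simp: f_def[abs_def])
  then have "(\<Sum>n. \<rho> (f n)) = \<rho> u + \<rho> v"
    by (simp add: f_def[abs_def])
  ultimately show ?thesis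
    using mono[of w "\<lambda>x. u x + v x"] suminf[of f] assms(4) by auto
qed

text \<open>On the set \<open>?Z\<close> of infinite values, \<open>top\<close> times the indicator
  stays below \<open>u\<close>. Homogeneity then makes \<open>top * \<rho> (indicator ?Z)\<close>
  finite, which forces \<open>\<rho> (indicator ?Z) = 0\<close>.\<close>

lemma AE_less_top:
  assumes [measurable]: "u \<in> borel_measurable borel" and "\<rho> u < top"
  shows "AE x in lborel. u x < top"
proof -
  let ?Z = "{x. u x = top}"
  have "top * \<rho> (indicator ?Z) = \<rho> (\<lambda>x. top * indicator ?Z x)"
    by (subst cmult) auto
  also have "\<dots> \<le> \<rho> u"
    by (intro mono AE_I2) (auto simp: indicator_def)
  finally have "\<rho> (indicator ?Z) = 0"
    using assms(2) by (auto simp: ennreal_top_mult split: if_splits)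
  then have "AE x in lborel. indicator ?Z x = (0 :: ennreal)"
    by (intro eq_0) auto
  then show ?thesis
    by eventually_elim (auto simp: less_top indicator_eq_0_iff)
qed

abbreviation "N f \<equiv> \<rho> (enorm f)"

lemma N_le_add:
  assumes [measurable]: "f \<in> borel_measurable borel" "g \<in> borel_measurable borel" "h \<in> borel_measurable borel"
    and "AE x in lborel. h x = f x + g x"
  shows "N h \<le> N f + N g"
proof (rule rho_le_add)
  show "AE x in lborel. enorm h x \<le> enorm f x + enorm g x"
    using assms(4) by eventually_elim (simp add: norm_triangle_ineq flip: ennreal_plus)
qed auto

lemma N_cmult:
  assumes "f \<in> borel_measurable borel"
  shows "N (\<lambda>x. c * f x) = ennreal (norm c powr s) * N f"
  using cmult[of "enorm f" "ennreal (norm c)"] assms by (simp add: norm_mult ennreal_mult ennpowr_ennreal)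

text \<open>The Riesz-Fischer argument. The bound is stated for every \<open>m\<close> because both
  ends matter: \<open>m = 0\<close> bounds the sum itself, and large \<open>m\<close> gives
  convergence.\<close>

lemma N_complete:
  assumes [measurable]: "\<And>n. x n \<in> borel_measurable borel" and fin: "(\<Sum>n. N (x n)) < top"
  obtains z where "z \<in> borel_measurable borel"
    "\<And>m. N (\<lambda>t. z t - (\<Sum>j<m. x j t)) \<le> (\<Sum>j. N (x (j + m)))"
proof
  define z where "z t = (\<Sum>n. x n t)" for t
  show [measurable]: "z \<in> borel_measurable borel"
    unfolding z_def[abs_def] by measurable
  \<comment> \<open>Countable subadditivity turns summability of the \<open>N (x n)\<close> into
    absolute convergence almost everywhere; the value of \<open>z\<close> on the remaining null set
    is immaterial.\<close>
  have "\<rho> (\<lambda>t. \<Sum>n. enorm (x n) t) < top"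
    by (rule le_less_trans[OF suminf fin]) measurable
  then have AE: "AE t in lborel. (\<Sum>n. enorm (x n) t) < top"
    by (intro AE_less_top) auto
  fix m
  have "N (\<lambda>t. z t - (\<Sum>j<m. x j t)) \<le> \<rho> (\<lambda>t. \<Sum>j. enorm (x (j + m)) t)"
  proof (rule mono)
    from AE show "AE t in lborel. enorm (\<lambda>t. z t - (\<Sum>j<m. x j t)) t \<le> (\<Sum>j. enorm (x (j + m)) t)"
    proof eventually_elim
      fix t assume "(\<Sum>n. enorm (x n) t) < top"
      then have sn: "summable (\<lambda>n. norm (x n t))"
        by (intro summable_suminf_not_top) auto
      then have s: "summable (\<lambda>n. x n t)" by (rule summable_norm_cancel)
      have sn': "summable (\<lambda>j. norm (x (j + m) t))"
        using sn by (subst summable_iff_shift)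
      have "z t - (\<Sum>j<m. x j t) = (\<Sum>j. x (j + m) t)"
        unfolding z_def using suminf_minus_initial_segment[OF s, of m] by simp
      then have "norm (z t - (\<Sum>j<m. x j t)) \<le> (\<Sum>j. norm (x (j + m) t))"
        using summable_norm[OF sn'] by simp
      then show "enorm (\<lambda>t. z t - (\<Sum>j<m. x j t)) t \<le> (\<Sum>j. enorm (x (j + m)) t)"
        using sn' by (subst suminf_ennreal2) (auto intro: ennreal_leI)
    qed
  qed auto
  also have "\<dots> \<le> (\<Sum>j. N (x (j + m)))"
    by (rule suminf) auto
  finally show "N (\<lambda>t. z t - (\<Sum>j<m. x j t)) \<le> (\<Sum>j. N (x (j + m)))" .
qed

lemma N_cconv_le:
  assumes [measurable]: "f \<in> borel_measurable borel" "g \<in> borel_measurable borel"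
    and f0: "\<And>x. x \<notin> cbox 0 One \<Longrightarrow> f x = 0" and fin: "(\<integral>\<^sup>+x. enorm f x \<partial>lborel) < top"
  shows "N (cconv f g) \<le> ennreal K * ennpowr (\<integral>\<^sup>+x. enorm f x \<partial>lborel) s * N g"
proof -
  have "N (cconv f g) \<le> \<rho> (nconv (enorm f) (enorm g))"
    by (intro mono AE_I2 enorm_cconv_le) auto
  also have "\<dots> \<le> ennreal K * ennpowr (\<integral>\<^sup>+x. enorm f x \<partial>lborel) s * N g"
    using f0 fin by (intro nconv_le) auto
  finally show ?thesis .
qed

lemma rho_nconv_less_top:
  assumes [measurable]: "u \<in> borel_measurable borel" "v \<in> borel_measurable borel"
    and "\<And>x. x \<notin> cbox 0 One \<Longrightarrow> u x = 0" "(\<integral>\<^sup>+x. u x \<partial>lborel) < top" "\<rho> v < top"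
  shows "\<rho> (nconv u v) < top"
  using assms by (intro le_less_trans[OF nconv_le]) (auto simp: ennreal_mult_less_top)

lemma AE_nconv_less_top:
  assumes "u \<in> borel_measurable borel" "v \<in> borel_measurable borel"
    and "\<And>x. x \<notin> cbox 0 One \<Longrightarrow> u x = 0" "(\<integral>\<^sup>+x. u x \<partial>lborel) < top" "\<rho> v < top"
  shows "AE x in lborel. nconv u v x < top"
  using assms by (intro AE_less_top rho_nconv_less_top borel_measurable_nconv)

end

section \<open>Inverting operators built from convolution by a kernel of mass at most 1\<close>

locale unit_kernel = conv_module +
  fixes e :: "'a \<Rightarrow> complex"
  assumes e_measurable [measurable]: "e \<in> borel_measurable borel"
    and e_outside: "\<And>x. x \<notin> cbox 0 One \<Longrightarrow> e x = 0"
    and e_le_1: "(\<integral>\<^sup>+x. enorm e x \<partial>lborel) \<le> 1"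
begin

lemma e_fin: "(\<integral>\<^sup>+x. enorm e x \<partial>lborel) < top"
  using e_le_1 by (rule le_less_trans) simp

lemma N_kernel_le:
  assumes "g \<in> borel_measurable borel"
  shows "N (cconv e g) \<le> ennreal K * N g"
proof -
  have "N (cconv e g) \<le> ennreal K * ennpowr (\<integral>\<^sup>+x. enorm e x \<partial>lborel) s * N g"
    using assms e_outside e_fin by (intro N_cconv_le) auto
  also have "\<dots> \<le> ennreal K * 1 * N g"
    using ennpowr_mono[OF _ e_le_1, of s] s_pos by (intro mult_mono) auto
  finally show ?thesis by simp
qed

lemma N_kernel_less_top:
  "g \<in> borel_measurable borel \<Longrightarrow> N g < top \<Longrightarrow> N (cconv e g) < top"
  by (rule le_less_trans[OF N_kernel_le]) (auto simp: ennreal_mult_less_top)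

lemma AE_kernel_less_top:
  assumes "g \<in> borel_measurable borel" "N g < top"
  shows "AE x in lborel. nconv (enorm e) (enorm g) x < top"
  using assms e_outside e_fin by (intro AE_nconv_less_top) auto

lemma AE_kernel_add:
  assumes [measurable]: "g \<in> borel_measurable borel" "h \<in> borel_measurable borel" and "N g < top" "N h < top"
  shows "AE x in lborel. cconv e (\<lambda>x. g x + h x) x = cconv e g x + cconv e h x"
  using AE_kernel_less_top[OF assms(1,3)] AE_kernel_less_top[OF assms(2,4)]
  by eventually_elim (auto intro: cconv_add_right)

lemma AE_kernel_diff:
  assumes [measurable]: "g \<in> borel_measurable borel" "h \<in> borel_measurable borel" and "N g < top" "N h < top"
  shows "AE x in lborel. cconv e (\<lambda>x. g x - h x) x = cconv e g x - cconv e h x"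
  using AE_kernel_add[of g "\<lambda>x. -1 * h x"] cconv_cmult_right[of e "-1" h] assms by simp

text \<open>\<open>t n\<close> is the \<open>n\<close>-th term of the Neumann series for convolution
  by \<open>- b e\<close>. Since \<open>N\<close> scales by \<open>b powr s\<close>, the assumption
  on \<open>K * b powr s\<close> makes each term at most half as large as the one before, whence the
  factor 2.\<close>

lemma neumann:
  assumes [measurable]: "d \<in> borel_measurable borel" and Nd: "N d < top"
    and b: "0 \<le> b" "K * b powr s \<le> 1 / 2"
  obtains z where "z \<in> borel_measurable borel" "N z \<le> 2 * N d"
    "AE x in lborel. z x + complex_of_real b * cconv e z x = d x"
proof -
  define t where "t = rec_nat d (\<lambda>_ t x. - complex_of_real b * cconv e t x)"
  have t_0: "t 0 = d" and t_Suc: "t (Suc n) = (\<lambda>x. - complex_of_real b * cconv e (t n) x)" for n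
    by (auto simp: t_def)
  have tm [measurable]: "t n \<in> borel_measurable borel" for n
    by (induction n) (auto simp: t_0 t_Suc)
  have half: "N (\<lambda>x. - complex_of_real b * cconv e g x) \<le> ennreal (1/2) * N g"
    if [measurable]: "g \<in> borel_measurable borel" for g
  proof -
    have "N (\<lambda>x. - complex_of_real b * cconv e g x) \<le> ennreal (b powr s) * (ennreal K * N g)"
      using b by (subst N_cmult) (auto intro!: mult_left_mono N_kernel_le)
    also have "\<dots> = ennreal (K * b powr s) * N g"
      using K_ge by (simp add: ennreal_mult' mult_ac)
    also have "\<dots> \<le> ennreal (1/2) * N g"
      using b by (intro mult_right_mono ennreal_leI) auto
    finally show ?thesis .
  qed
  have Nt: "N (t n) \<le> ennreal ((1/2) ^ n) * N d" for n
  proof (induction n)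
    case (Suc n)
    have "N (t (Suc n)) \<le> ennreal (1/2) * N (t n)"
      unfolding t_Suc by (rule half) simp
    also have "\<dots> \<le> ennreal (1/2) * (ennreal ((1/2) ^ n) * N d)"
      by (intro mult_left_mono Suc) auto
    also have "\<dots> = (ennreal (1/2) * ennreal ((1/2) ^ n)) * N d"
      by (simp only: mult.assoc)
    also have "ennreal (1/2) * ennreal ((1/2) ^ n) = ennreal ((1/2) ^ Suc n)"
      by (subst ennreal_mult[symmetric]) auto
    finally show ?case .
  qed (simp add: t_0)
  have "(\<lambda>n. (1/2::real) ^ n) sums 2"
    using geometric_sums[of "1/2::real"] by simp
  then have "(\<Sum>n. ennreal ((1/2) ^ n)) = ennreal 2"
    by (rule suminf_ennreal_eq[rotated]) simp
  then have geo: "(\<Sum>n. ennreal ((1/2) ^ n) * N d) = 2 * N d"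
    by (simp only: ennreal_suminf_multc ennreal_numeral)
  have sum_le: "(\<Sum>n. N (t n)) \<le> 2 * N d"
    unfolding geo[symmetric] by (intro suminf_le Nt) auto
  have "2 * N d < top" using Nd by (simp add: ennreal_mult_less_top)
  with sum_le have sum_fin: "(\<Sum>n. N (t n)) < top"
    by (rule le_less_trans)
  obtain z where [measurable]: "z \<in> borel_measurable borel"
    and z: "\<And>m. N (\<lambda>x. z x - (\<Sum>j<m. t j x)) \<le> (\<Sum>j. N (t (j + m)))"
    by (rule N_complete[OF tm sum_fin]) (rule that)
  have Nz: "N z \<le> 2 * N d"
    using order.trans[OF z[of 0]] sum_le by simp
  have Nt_fin: "N (t n) < top" for n
    using sum_le_suminf[of "\<lambda>n. N (t n)" "{n}"] sum_fin by (auto intro: le_less_trans)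
  define y where "y m x = (\<Sum>j<m. t j x)" for m x
  have [measurable]: "y m \<in> borel_measurable borel" for m
    unfolding y_def[abs_def] by measurable
  have Ny_fin: "N (y m) < top" for m
  proof (induction m)
    case (Suc m)
    have "N (y (Suc m)) \<le> N (y m) + N (t m)"
      by (intro N_le_add AE_I2) (auto simp: y_def)
    then show ?case using Suc Nt_fin[of m] by (auto intro: le_less_trans)
  qed (simp add: y_def)
  \<comment> \<open>Telescoping: the operator applied to a partial sum gives \<open>d\<close> up to
    the first omitted term.\<close>
  have y: "AE x in lborel. y m x + complex_of_real b * cconv e (y m) x = d x - t m x" for m
  proof (induction m)
    case 0
    show ?case by (simp add: y_def t_0 cconv_def)
  next
    case (Suc m)
    have "y (Suc m) = (\<lambda>x. y m x + t m x)" by (simp add: y_def[abs_def])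
    have "AE x in lborel. cconv e (y (Suc m)) x = cconv e (y m) x + cconv e (t m) x"
      unfolding \<open>y (Suc m) = _\<close> by (intro AE_kernel_add Ny_fin Nt_fin) auto
    with Suc show ?case
      by eventually_elim (simp add: \<open>y (Suc m) = _\<close> t_Suc algebra_simps)
  qed
  \<comment> \<open>The defect of the limit. Comparison with the partial sum \<open>y m\<close>
    splits it, up to sign, into \<open>w = z - y m\<close>, \<open>b\<close> times the convolution
    of \<open>w\<close>, and \<open>t m\<close>. Each is bounded by the tail, hence the factor
    3.\<close>
  define r where "r x = z x + complex_of_real b * cconv e z x - d x" for x
  have [measurable]: "r \<in> borel_measurable borel"
    unfolding r_def[abs_def] by measurable
  have Nr: "N r \<le> 3 * (\<Sum>j. N (t (j + m)))" for m
  proof -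
    let ?T = "\<Sum>j. N (t (j + m))"
    define w where "w x = z x - y m x" for x
    have [measurable]: "w \<in> borel_measurable borel"
      unfolding w_def[abs_def] by measurable
    have Nw: "N w \<le> ?T" unfolding w_def y_def by (rule z)
    have bw: "N (\<lambda>x. - complex_of_real b * cconv e w x) \<le> ?T"
    proof -
      have "N (\<lambda>x. - complex_of_real b * cconv e w x) \<le> ennreal (1/2) * N w"
        by (rule half) simp
      also have "\<dots> \<le> ennreal 1 * N w"
        by (intro mult_right_mono ennreal_leI) auto
      finally show ?thesis using Nw by simp
    qed
    have "AE x in lborel. cconv e w x = cconv e z x - cconv e (y m) x"
      unfolding w_def[abs_def] using Nz Nd Ny_fin
      by (intro AE_kernel_diff) (auto intro: le_less_trans simp: ennreal_mult_less_top)
    with y[of m] have eq: "AE x in lborel. r x = (w x - (- complex_of_real b * cconv e w x)) + (- t m x)"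
    proof eventually_elim
      fix x assume 1: "y m x + complex_of_real b * cconv e (y m) x = d x - t m x"
        and 2: "cconv e w x = cconv e z x - cconv e (y m) x"
      from 1 have "d x = y m x + complex_of_real b * cconv e (y m) x + t m x" by simp
      then show "r x = (w x - (- complex_of_real b * cconv e w x)) + (- t m x)"
        unfolding r_def 2 by (simp add: w_def algebra_simps)
    qed
    have "N r \<le> N (\<lambda>x. w x - (- complex_of_real b * cconv e w x)) + N (\<lambda>x. - t m x)"
      using eq by (intro N_le_add) auto
    also have "N (\<lambda>x. w x - (- complex_of_real b * cconv e w x))
        \<le> N w + N (\<lambda>x. - (- complex_of_real b * cconv e w x))"
      by (intro N_le_add) auto
    also have "N (\<lambda>x. - t m x) = N (t m)" by simp
    also have "N (t m) \<le> ?T"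
      using sum_le_suminf[of "\<lambda>j. N (t (j + m))" "{0}"] by simp
    finally have "N r \<le> ?T + ?T + ?T"
      using Nw bw by (simp add: add_mono order.trans)
    also have "?T + ?T + ?T = (1 + 1 + 1) * ?T"
      by (simp only: distrib_right mult_1)
    finally show ?thesis by simp
  qed
  have "(\<lambda>m. 3 * (\<Sum>j. N (t (j + m)))) \<longlonglongrightarrow> 3 * 0"
    using tendsto_suminf_tail_0[OF sum_fin] by (intro tendsto_mult_ennreal tendsto_const) auto
  then have "N r \<le> 3 * 0"
    by (rule LIMSEQ_le_const) (use Nr in auto)
  then have "AE x in lborel. r x = 0"
    using eq_0[of "enorm r"] by simp
  then have "AE x in lborel. z x + complex_of_real b * cconv e z x = d x"
    by eventually_elim (simp add: r_def)
  with Nz show ?thesis by (intro that) auto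
qed

text \<open>Since \<open>a = b * (1 - a)\<close>, the operator is \<open>1 - a\<close> times the one
  inverted by the Neumann series. Solving for the correction \<open>y - x\<close> instead of
  \<open>y\<close> makes the right-hand side \<open>b\<close> times the difference of
  \<open>x\<close> and its convolution. Thus \<open>y\<close> is close to \<open>x\<close> whenever
  convolution by \<open>e\<close> moves \<open>x\<close> little.\<close>

lemma resolvent:
  assumes [measurable]: "x \<in> borel_measurable borel" and Nx: "N x < top"
    and b: "0 \<le> b" "b \<le> 1" "K * b powr s \<le> 1 / 2" and a: "a = b / (1 + b)"
  obtains y where "y \<in> borel_measurable borel" "N y < top" "N (\<lambda>t. y t - x t) \<le> 2 * N (\<lambda>t. cconv e x t - x t)"
    "AE t in lborel. complex_of_real (1 - a) * y t + complex_of_real a * cconv e y t = x t"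
proof -
  define d where "d t = complex_of_real b * (x t - cconv e x t)" for t
  have [measurable]: "d \<in> borel_measurable borel"
    unfolding d_def[abs_def] by measurable
  have "N (\<lambda>t. x t - cconv e x t) \<le> N x + N (\<lambda>t. - cconv e x t)"
    by (intro N_le_add) auto
  then have fin: "N (\<lambda>t. x t - cconv e x t) < top"
    using N_kernel_less_top[of x] Nx by (auto intro: le_less_trans)
  have "N d = ennreal (b powr s) * N (\<lambda>t. x t - cconv e x t)"
    unfolding d_def using b by (subst N_cmult) auto
  also have "\<dots> \<le> 1 * N (\<lambda>t. x t - cconv e x t)"
    using b s_pos powr_mono2[of s b 1] by (intro mult_right_mono) (auto simp flip: ennreal_1 intro!: ennreal_leI)
  finally have Nd: "N d \<le> N (\<lambda>t. cconv e x t - x t)"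
    by (simp add: norm_minus_commute)
  also have "\<dots> < top" using fin by (simp add: norm_minus_commute)
  finally have Nd_fin: "N d < top" .
  from neumann[of d b] b Nd_fin obtain z where [measurable]: "z \<in> borel_measurable borel"
    and Nz: "N z \<le> 2 * N d" and z: "AE t in lborel. z t + complex_of_real b * cconv e z t = d t"
    by auto
  have Nz_fin: "N z < top"
    using Nz Nd_fin by (auto intro: le_less_trans simp: ennreal_mult_less_top)
  show thesis
  proof
    show "(\<lambda>t. x t + z t) \<in> borel_measurable borel" by measurable
    have "N (\<lambda>t. x t + z t) \<le> N x + N z" by (intro N_le_add) auto
    then show "N (\<lambda>t. x t + z t) < top" using Nx Nz_fin by (auto intro: le_less_trans)
    show "N (\<lambda>t. x t + z t - x t) \<le> 2 * N (\<lambda>t. cconv e x t - x t)"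
      using Nz mult_left_mono[OF Nd, of 2] by simp
    have "a = b * (1 - a)"
      using a b by (simp add: field_simps)
    then have a': "complex_of_real a = complex_of_real b * complex_of_real (1 - a)"
      by (metis of_real_mult)
    have "AE t in lborel. cconv e (\<lambda>t. x t + z t) t = cconv e x t + cconv e z t"
      using Nx Nz_fin by (intro AE_kernel_add) auto
    with z show "AE t in lborel. complex_of_real (1 - a) * (x t + z t) + complex_of_real a * cconv e (\<lambda>t. x t + z t) t = x t"
    proof eventually_elim
      fix t assume *: "z t + complex_of_real b * cconv e z t = d t"
        "cconv e (\<lambda>t. x t + z t) t = cconv e x t + cconv e z t"
      have "complex_of_real (1 - a) * (x t + z t) + complex_of_real a * cconv e (\<lambda>t. x t + z t) t
          = complex_of_real (1 - a) * (x t + complex_of_real b * cconv e x t + (z t + complex_of_real b * cconv e z t))"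
        unfolding *(2) by (subst a') (simp add: algebra_simps)
      also have "\<dots> = complex_of_real (1 - a) * (1 + complex_of_real b) * x t"
        unfolding * d_def by (simp add: algebra_simps)
      also have "complex_of_real (1 - a) * (1 + complex_of_real b) = complex_of_real ((1 - a) * (1 + b))"
        by simp
      also have "(1 - a) * (1 + b) = 1"
        using a b by (simp add: field_simps)
      finally show "complex_of_real (1 - a) * (x t + z t) + complex_of_real a * cconv e (\<lambda>t. x t + z t) t = x t"
        by simp
    qed
  qed
qed

end

section \<open>Approximate identities\<close>

text \<open>The cube has a corner at 0 and not its centre. Sums of points of such cubes stay in the
  positive orthant, so the supports of repeated convolutions can be kept inside
  \<open>cbox 0 One\<close>.\<close>

definition mollifier :: "nat \<Rightarrow> 'a::euclidean_space \<Rightarrow> complex" where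
  "mollifier n x = complex_of_real (indicator (cbox 0 ((1/2) ^ n *\<^sub>R One)) x /
     measure lborel (cbox 0 ((1/2) ^ n *\<^sub>R One) :: 'a set))"

lemma mollifier_measurable [measurable]: "mollifier n \<in> borel_measurable borel"
  unfolding mollifier_def[abs_def] by measurable

lemma mollifier_outside: "x \<notin> cbox 0 ((1/2) ^ n *\<^sub>R One) \<Longrightarrow> mollifier n x = 0"
  by (simp add: mollifier_def)

lemma mollifier_volume_pos: "0 < measure lborel (cbox 0 ((1/2) ^ n *\<^sub>R One) :: 'a::euclidean_space set)"
  by (simp add: content_pos_lt_eq)

lemma nn_integral_mollifier: "(\<integral>\<^sup>+x. enorm (mollifier n) x \<partial>(lborel :: 'a::euclidean_space measure)) = 1"
proof -
  let ?B = "cbox 0 ((1/2) ^ n *\<^sub>R One) :: 'a set"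
  define V where "V = measure lborel ?B"
  have V: "0 < V" unfolding V_def by (rule mollifier_volume_pos)
  have "enorm (mollifier n) x = ennreal (1 / V) * indicator ?B x" for x
    unfolding mollifier_def V_def[symmetric] norm_of_real using V by (auto simp: indicator_def)
  then have "(\<integral>\<^sup>+x. enorm (mollifier n) x \<partial>(lborel :: 'a measure)) = ennreal (1 / V) * emeasure lborel ?B"
    by (simp only:) (simp only: nn_integral_cmult_indicator sets_lborel borel_closed closed_cbox)
  also have "emeasure lborel ?B = ennreal V"
    unfolding V_def by (intro emeasure_eq_ennreal_measure) (simp add: emeasure_lborel_cbox_eq)
  finally show ?thesis
    using V by (simp add: ennreal_mult[symmetric])
qed

lemma integral_mollifier: "(\<integral>x. mollifier n x \<partial>(lborel :: 'a::euclidean_space measure)) = 1"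
proof -
  let ?B = "cbox 0 ((1/2) ^ n *\<^sub>R One) :: 'a set"
  have "(\<integral>x. mollifier n x \<partial>(lborel :: 'a measure)) = complex_of_real (\<integral>x. indicator ?B x / measure lborel ?B \<partial>lborel)"
    unfolding mollifier_def by (rule integral_complex_of_real)
  also have "(\<integral>x. indicator ?B x / measure lborel ?B \<partial>lborel) = 1"
    using mollifier_volume_pos[of n, where 'a='a] by (simp del: content_cbox_if)
  finally show ?thesis by simp
qed

lemma dyadic_cbox_subset: "cbox 0 ((1/2) ^ n *\<^sub>R One) \<subseteq> (cbox 0 One :: 'a::euclidean_space set)"
  by (auto simp: subset_box power_le_one)

text \<open>Near a point off the frontier the indicator is constant, and a mollifier with a small
  enough cube averages only over that neighbourhood.\<close>

lemma eventually_cconv_mollifier_indicator: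
  fixes A :: "'a::euclidean_space set"
  assumes x: "x \<notin> frontier A"
  shows "eventually (\<lambda>n. cconv (mollifier n) (indicator A) x = indicator A x) sequentially"
proof -
  obtain r where r: "0 < r" "\<And>y. dist x y < r \<Longrightarrow> (indicator A y :: complex) = indicator A x"
  proof (cases "x \<in> A")
    case True
    then have "x \<in> interior A"
      using x closure_subset[of A] by (auto simp: frontier_def)
    then show ?thesis
      using that True by (auto simp: mem_interior indicator_def subset_iff)
  next
    case False
    then have "x \<in> interior (- A)"
      using x interior_subset[of A] by (auto simp: frontier_def interior_closure)
    then show ?thesis
      using that False by (auto simp: mem_interior indicator_def subset_iff)
  qed
  \<comment> \<open>Every point of the cube of side \<open>(1/2) ^ n\<close> has norm at most the
    sum of its coordinates, hence at most this number.\<close>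
  have "(\<lambda>n. real DIM('a) * (1/2) ^ n) \<longlonglongrightarrow> real DIM('a) * 0"
    by (intro tendsto_mult tendsto_const LIMSEQ_power_zero) auto
  then have "eventually (\<lambda>n. real DIM('a) * (1/2) ^ n < r) sequentially"
    using r(1) by (intro order_tendstoD(2)) auto
  then show ?thesis
  proof eventually_elim
    fix n assume n: "real DIM('a) * (1/2) ^ n < r"
    have "mollifier n (x - y) * indicator A y = indicator A x * mollifier n (x - y)" for y
    proof (cases "x - y \<in> cbox 0 ((1/2) ^ n *\<^sub>R One)")
      case True
      have "dist x y \<le> (\<Sum>b\<in>Basis. \<bar>(x - y) \<bullet> b\<bar>)"
        unfolding dist_norm by (rule norm_le_l1)
      also have "\<dots> \<le> (\<Sum>b\<in>(Basis :: 'a set). (1/2) ^ n)"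
        using True by (intro sum_mono) (auto simp: mem_box)
      also have "\<dots> < r" using n by simp
      finally show ?thesis using r(2) by simp
    qed (simp add: mollifier_outside)
    then have "cconv (mollifier n) (indicator A) x = (\<integral>y. indicator A x * mollifier n (x - y) \<partial>lborel)"
      unfolding cconv_def by (simp only:)
    also have "\<dots> = indicator A x * (\<integral>y. mollifier n (x - y) \<partial>lborel)"
      by simp
    also have "\<dots> = indicator A x"
      by (simp add: integral_lborel_minus integral_mollifier)
    finally show "cconv (mollifier n) (indicator A) x = indicator A x" .
  qed
qed

lemma cconv_outside:
  assumes "\<And>x. x \<notin> A \<Longrightarrow> f x = 0" "\<And>x. x \<notin> B \<Longrightarrow> g x = 0" "\<And>a b. a \<in> A \<Longrightarrow> b \<in> B \<Longrightarrow> a + b \<in> C" "x \<notin> C"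
  shows "cconv f g x = 0"
proof -
  have "f (x - y) * g y = 0" for y
    using assms(1)[of "x - y"] assms(2)[of y] assms(3)[of "x - y" y] assms(4) by auto
  then show ?thesis by (simp only: cconv_def integral_zero)
qed

text \<open>The L1 norm as a module over itself makes completeness and the convergence of mollifiers
  available for the kernels \<open>F\<^sub>n\<close> as well.\<close>

interpretation L1: conv_module "\<lambda>u :: 'a::euclidean_space \<Rightarrow> ennreal. \<integral>\<^sup>+x. u x \<partial>lborel" 1 1
proof
  fix w :: "nat \<Rightarrow> 'a \<Rightarrow> ennreal" and v
  assume *: "\<And>n. w n \<in> borel_measurable borel" "v \<in> borel_measurable borel"
    "AE x in lborel. (\<lambda>n. w n x) \<longlonglongrightarrow> 0" "\<And>n. AE x in lborel. w n x \<le> v x"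
    "(\<integral>\<^sup>+x. v x \<partial>lborel) < top"
  show "(\<lambda>n. \<integral>\<^sup>+x. w n x \<partial>lborel) \<longlonglongrightarrow> 0"
    using tendsto_nrm_0[of 1 w lborel v] * by (simp add: nrm_def)
next
  fix A :: "'a set" assume "A \<in> sets borel" "bounded A"
  then show "(\<integral>\<^sup>+x. indicator A x \<partial>lborel) < top"
    using emeasure_bounded_finite[of A] by simp
qed (auto simp: nn_integral_suminf nn_integral_cmult nn_integral_0_iff_AE nn_integral_nconv
       intro: nn_integral_mono_AE)

sublocale conv_module \<subseteq> mol: unit_kernel \<rho> s K "mollifier n" for n
proof
  show "mollifier n x = 0" if "x \<notin> cbox 0 One" for x :: 'a
    using that dyadic_cbox_subset by (intro mollifier_outside) auto
qed (auto simp: nn_integral_mollifier)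

section \<open>Convergence of the mollifiers to the identity in every such module\<close>

context conv_module
begin

text \<open>This set will turn out to be a linear space, closed under limits of finite
  \<open>N\<close>, that contains enough indicators to exhaust all \<open>g\<close> with
  \<open>N g < top\<close>.\<close>

definition approximable :: "('a \<Rightarrow> complex) set" where
  "approximable = {g \<in> borel_measurable borel. N g < top \<and>
     (\<lambda>n. N (\<lambda>x. cconv (mollifier n) g x - g x)) \<longlonglongrightarrow> 0}"

lemma approximableD [dest]:
  assumes "g \<in> approximable"
  shows "g \<in> borel_measurable borel" "N g < top" "(\<lambda>n. N (\<lambda>x. cconv (mollifier n) g x - g x)) \<longlonglongrightarrow> 0"
  using assms by (auto simp: approximable_def)

lemma tendsto_0_le:
  assumes "\<And>n. a n \<le> (b n :: ennreal)" "(b \<longlongrightarrow> 0) sequentially"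
  shows "(a \<longlongrightarrow> 0) sequentially"
  using assms by (intro tendsto_sandwich[OF _ _ tendsto_const assms(2)]) auto

lemma approximable_zero: "(\<lambda>x. 0) \<in> approximable"
  by (simp add: approximable_def cconv_def)

lemma approximable_add:
  assumes f: "f \<in> approximable" and g: "g \<in> approximable"
  shows "(\<lambda>x. f x + g x) \<in> approximable"
proof -
  note [measurable] = approximableD(1)[OF f] approximableD(1)[OF g]
  have "N (\<lambda>x. f x + g x) \<le> N f + N g"
    by (intro N_le_add) auto
  also have "\<dots> < top"
    using approximableD(2)[OF f] approximableD(2)[OF g] by simp
  finally have 1: "N (\<lambda>x. f x + g x) < top" .
  have le: "N (\<lambda>x. cconv (mollifier n) (\<lambda>x. f x + g x) x - (f x + g x)) \<le>
     N (\<lambda>x. cconv (mollifier n) f x - f x) + N (\<lambda>x. cconv (mollifier n) g x - g x)" for n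
  proof (intro N_le_add)
    have "AE x in lborel. cconv (mollifier n) (\<lambda>x. f x + g x) x = cconv (mollifier n) f x + cconv (mollifier n) g x"
      using f g by (intro mol.AE_kernel_add) auto
    then show "AE x in lborel. cconv (mollifier n) (\<lambda>x. f x + g x) x - (f x + g x) =
      (cconv (mollifier n) f x - f x) + (cconv (mollifier n) g x - g x)"
      by eventually_elim simp
  qed auto
  have lim: "(\<lambda>n. N (\<lambda>x. cconv (mollifier n) f x - f x) + N (\<lambda>x. cconv (mollifier n) g x - g x)) \<longlonglongrightarrow> 0"
    using tendsto_add[OF approximableD(3)[OF f] approximableD(3)[OF g]] by simp
  from 1 tendsto_0_le[OF le lim] show ?thesis by (simp add: approximable_def)
qed

lemma approximable_cmult:
  assumes g: "g \<in> approximable"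
  shows "(\<lambda>x. c * g x) \<in> approximable"
proof -
  note [measurable] = approximableD(1)[OF g]
  have eq: "N (\<lambda>x. cconv (mollifier n) (\<lambda>x. c * g x) x - c * g x) =
     ennreal (norm c powr s) * N (\<lambda>x. cconv (mollifier n) g x - g x)" for n
    unfolding cconv_cmult_right right_diff_distrib[symmetric] by (rule N_cmult) measurable
  have "(\<lambda>n. N (\<lambda>x. cconv (mollifier n) (\<lambda>x. c * g x) x - c * g x)) \<longlonglongrightarrow> ennreal (norm c powr s) * 0"
    unfolding eq by (intro tendsto_mult_ennreal approximableD g) auto
  then show ?thesis
    using approximableD(2)[OF g] by (simp add: approximable_def N_cmult ennreal_mult_less_top)
qed

lemma approximable_sum:
  "finite I \<Longrightarrow> (\<And>i. i \<in> I \<Longrightarrow> f i \<in> approximable) \<Longrightarrow> (\<lambda>x. \<Sum>i\<in>I. f i x) \<in> approximable"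
  by (induction I rule: finite_induct) (auto intro: approximable_add approximable_zero)

text \<open>All mollifiers share the bound \<open>K\<close>, so the error for \<open>g\<close>
  exceeds that for \<open>h i\<close> by at most \<open>K + 1\<close> times \<open>N\<close> of the
  difference of \<open>h i\<close> and \<open>g\<close>.\<close>

lemma approximable_limit:
  assumes [measurable]: "g \<in> borel_measurable borel" and Ng: "N g < top"
    and h: "\<And>i. h i \<in> approximable" and lim: "(\<lambda>i. N (\<lambda>x. h i x - g x)) \<longlonglongrightarrow> 0"
  shows "g \<in> approximable"
proof -
  note [measurable] = approximableD(1)[OF h]
  have "(\<lambda>n. N (\<lambda>x. cconv (mollifier n) g x - g x)) \<longlonglongrightarrow> 0"
  proof (rule tendsto_0_ennrealI)
    fix \<epsilon> :: real assume \<epsilon>: "0 < \<epsilon>"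
    have "(\<lambda>i. (ennreal K + 1) * N (\<lambda>x. h i x - g x)) \<longlonglongrightarrow> (ennreal K + 1) * 0"
      by (intro tendsto_mult_ennreal lim tendsto_const) auto
    then have "eventually (\<lambda>i. (ennreal K + 1) * N (\<lambda>x. h i x - g x) < ennreal (\<epsilon> / 2)) sequentially"
      using \<epsilon> by (intro order_tendstoD(2)) auto
    then obtain i where i: "(ennreal K + 1) * N (\<lambda>x. h i x - g x) < ennreal (\<epsilon> / 2)"
      by (auto simp: eventually_sequentially)
    have "eventually (\<lambda>n. N (\<lambda>x. cconv (mollifier n) (h i) x - h i x) < ennreal (\<epsilon> / 2)) sequentially"
      using \<epsilon> by (intro order_tendstoD(2)[OF approximableD(3)[OF h]]) auto
    then show "eventually (\<lambda>n. N (\<lambda>x. cconv (mollifier n) g x - g x) \<le> ennreal \<epsilon>) sequentially"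
    proof eventually_elim
      fix n assume n: "N (\<lambda>x. cconv (mollifier n) (h i) x - h i x) < ennreal (\<epsilon> / 2)"
      let ?d = "\<lambda>x. h i x - g x"
      have "AE x in lborel. cconv (mollifier n) ?d x = cconv (mollifier n) (h i) x - cconv (mollifier n) g x"
        by (intro mol.AE_kernel_diff Ng approximableD(2)[OF h]) auto
      then have "N (\<lambda>x. cconv (mollifier n) g x - g x) \<le>
          N (\<lambda>x. cconv (mollifier n) (h i) x - h i x) + N (\<lambda>x. ?d x - cconv (mollifier n) ?d x)"
        by (intro N_le_add) (auto elim!: eventually_mono)
      moreover have "N (\<lambda>x. ?d x - cconv (mollifier n) ?d x) \<le> N ?d + N (\<lambda>x. - cconv (mollifier n) ?d x)"
        by (intro N_le_add) auto
      moreover have "N (\<lambda>x. - cconv (mollifier n) ?d x) \<le> ennreal K * N ?d"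
        using mol.N_kernel_le[of ?d n] by simp
      ultimately have "N (\<lambda>x. cconv (mollifier n) g x - g x) \<le> ennreal (\<epsilon> / 2) + (N ?d + ennreal K * N ?d)"
        using n by (meson add_mono order.trans less_imp_le order_refl)
      also have "N ?d + ennreal K * N ?d = (ennreal K + 1) * N ?d"
        by (simp add: distrib_right add.commute)
      also have "ennreal (\<epsilon> / 2) + \<dots> \<le> ennreal (\<epsilon> / 2) + ennreal (\<epsilon> / 2)"
        using i by (intro add_left_mono) auto
      also have "\<dots> = ennreal \<epsilon>"
        using \<epsilon> by (simp flip: ennreal_plus)
      finally show "N (\<lambda>x. cconv (mollifier n) g x - g x) \<le> ennreal \<epsilon>" .
    qed
  qed
  with Ng show ?thesis by (simp add: approximable_def)
qed

text \<open>Off the frontier the error is eventually 0; moreover it is bounded by 2 and lives on a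
  fixed ball. This is a case for \<open>dominated\<close>.\<close>

lemma approximable_indicator_null_frontier:
  fixes A :: "'a set"
  assumes [measurable]: "A \<in> sets borel" and A: "bounded A" and fr: "AE x in lborel. x \<notin> frontier A"
  shows "indicator A \<in> approximable"
proof -
  have eA: "enorm (indicator A :: 'a \<Rightarrow> complex) = indicator A"
    by (auto simp: indicator_def)
  obtain R where R: "A \<subseteq> cball 0 R" using bounded_subset_ballD[OF A, of 0] ball_subset_cball by (meson order_trans)
  obtain R' where R': "cbox 0 One \<subseteq> cball (0::'a) R'" using bounded_subset_ballD[OF bounded_cbox, of "0::'a" One 0] ball_subset_cball by (meson order_trans)
  \<comment> \<open>The ball contains \<open>A\<close> as well as all sums of a point of
    \<open>A\<close> and a point of the unit cube; \<open>max 0\<close> yields the former at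
    once.\<close>
  define B where "B = cball (0::'a) (max 0 R' + R)"
  have outside: "cconv (mollifier n) (indicator A) x = 0" if "x \<notin> B" for n x
  proof (rule cconv_outside[where A="cbox 0 One" and B=A and C=B])
    fix a b assume "a \<in> cbox (0::'a) One" "b \<in> A"
    then have "norm a \<le> R'" "norm b \<le> R" using R R' by auto
    then show "a + b \<in> B" using norm_triangle_ineq[of a b] by (auto simp: B_def)
  qed (use that mol.e_outside in auto)
  have [measurable]: "B \<in> sets borel" by (simp add: B_def)
  have AB: "A \<subseteq> B" using R by (auto simp: B_def)
  have bound: "norm (cconv (mollifier n) (indicator A) x - indicator A x) \<le> 2" for n x
  proof -
    have "ennreal (norm (cconv (mollifier n) (indicator A) x)) \<le> nconv (enorm (mollifier n)) (enorm (indicator A)) x"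
      by (rule enorm_cconv_le)
    also have "\<dots> \<le> (\<integral>\<^sup>+y. enorm (mollifier n) (x - y) * 1 \<partial>lborel)"
      unfolding nconv_def eA by (intro nn_integral_mono mult_left_mono) (auto simp: indicator_def)
    also have "\<dots> = ennreal 1"
      using nn_integral_lborel_minus[of "enorm (mollifier n)" x] by (simp add: nn_integral_mollifier)
    finally have "norm (cconv (mollifier n) (indicator A) x) \<le> 1"
      by (subst (asm) ennreal_le_iff) auto
    moreover have "norm (indicator A x :: complex) \<le> 1" by (auto simp: indicator_def)
    ultimately show ?thesis
      using norm_triangle_ineq4[of "cconv (mollifier n) (indicator A) x" "indicator A x"] by linarith
  qed
  have "(\<lambda>n. N (\<lambda>x. cconv (mollifier n) (indicator A) x - indicator A x)) \<longlonglongrightarrow> 0"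
  proof (rule dominated)
    show "AE x in lborel. (\<lambda>n. enorm (\<lambda>x. cconv (mollifier n) (indicator A) x - indicator A x) x) \<longlonglongrightarrow> 0"
      using fr
    proof eventually_elim
      fix x assume "x \<notin> frontier A"
      from eventually_cconv_mollifier_indicator[OF this]
      show "(\<lambda>n. enorm (\<lambda>x. cconv (mollifier n) (indicator A) x - indicator A x) x) \<longlonglongrightarrow> 0"
        by (intro tendsto_eventually) (auto elim!: eventually_mono)
    qed
    show "AE x in lborel. enorm (\<lambda>x. cconv (mollifier n) (indicator A) x - indicator A x) x \<le> 2 * indicator B x" for n
    proof (rule AE_I2)
      show "enorm (\<lambda>x. cconv (mollifier n) (indicator A) x - indicator A x) x \<le> 2 * indicator B x" for x
      proof (cases "x \<in> B")
        case True
        then show ?thesis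
          using ennreal_leI[OF bound[of n x]] by simp
      qed (use AB outside in \<open>auto simp: indicator_def\<close>)
    qed
    have "\<rho> (\<lambda>x. 2 * indicator B x) = ennpowr 2 s * \<rho> (indicator B)"
      by (rule cmult) measurable
    also have "\<dots> < top"
      using bounded[of B] by (auto simp: B_def ennreal_mult_less_top)
    finally show "\<rho> (\<lambda>x. 2 * indicator B x) < top" .
  qed measurable
  then show ?thesis
    using bounded[of A] A unfolding approximable_def mem_Collect_eq eA by simp
qed

text \<open>Boxes have null frontiers because they are convex, and they form an intersection-stable
  generator, so a Dynkin class argument reaches all Borel sets. The fixed box keeps complements and
  countable unions at finite norm.\<close>

lemma approximable_indicator:
  fixes A :: "'a set"
  assumes "A \<in> sets borel"
  shows "indicator (A \<inter> box a b) \<in> approximable"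
proof -
  have box_null: "AE x in lborel. x \<notin> frontier (box c d)" for c d :: 'a
  proof -
    have "negligible (frontier (box c d))"
      by (intro negligible_convex_frontier convex_box)
    then show ?thesis
      by (metis AE_completion_iff AE_not_in negligible_iff_null_sets)
  qed
  have box: "indicator (box c d) \<in> approximable" for c d :: 'a
    by (intro approximable_indicator_null_frontier box_null bounded_box) auto
  have 1: "Int_stable (range (\<lambda>(a, b). box a b :: 'a set))"
    by (auto simp: Int_stable_def box_Int_box)
  have sets: "sets borel = sigma_sets UNIV (range (\<lambda>(a, b). box a b :: 'a set))"
    by (subst borel_eq_box) simp
  have 2: "range (\<lambda>(a, b). box a b :: 'a set) \<subseteq> Pow UNIV" by simp
  from 1 2 assms[unfolded sets] show ?thesis
  proof (induction rule: sigma_sets_induct_disjoint)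
    case (basic A)
    then show ?case using box by (auto simp: box_Int_box)
  next
    case empty
    have "(\<lambda>x. 0) = (indicator ({} \<inter> box a b) :: 'a \<Rightarrow> complex)" by auto
    then show ?case using approximable_zero by simp
  next
    case (compl A)
    have "(\<lambda>x. indicator (box a b) x + (-1) * indicator (A \<inter> box a b) x) = (indicator ((UNIV - A) \<inter> box a b) :: 'a \<Rightarrow> complex)"
      by (auto simp: indicator_def fun_eq_iff)
    then show ?case using approximable_add[OF box[of a b] approximable_cmult[OF compl.IH, of "-1"]] by simp
  next
    case (union A)
    let ?B = "\<lambda>i. A i \<inter> box a b"
    have A [measurable]: "A i \<in> sets borel" for i
      using union.hyps(2) by (auto simp: sets)
    have disj: "disjoint_family ?B"
      using union.hyps(1) by (auto simp: disjoint_family_on_def)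
    have eq: "(\<Sum>j<i. indicator (?B j) x) = (indicator (\<Union>j<i. ?B j) x :: complex)" for i x
      by (rule indicator_UN_disjoint[symmetric]) (use disj in \<open>auto simp: disjoint_family_on_def\<close>)
    have UN: "(\<Union>i. A i) \<inter> box a b = (\<Union>i. ?B i)" by auto
    have dom: "(\<lambda>i. N (\<lambda>x. (\<Sum>j<i. indicator (?B j) x) - indicator (\<Union>i. ?B i) x)) \<longlonglongrightarrow> 0"
    proof (rule dominated)
      show "AE x in lborel. (\<lambda>i. enorm (\<lambda>x. (\<Sum>j<i. indicator (?B j) x) - indicator (\<Union>i. ?B i) x) x) \<longlonglongrightarrow> 0"
      proof (rule AE_I2)
        fix x
        have "(\<lambda>i. indicator (\<Union>j<i. ?B j) x - indicator (\<Union>i. ?B i) x :: complex) \<longlonglongrightarrow>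
           indicator (\<Union>i. ?B i) x - indicator (\<Union>i. ?B i) x"
          by (intro tendsto_diff tendsto_const LIMSEQ_indicator_UN)
        then have "(\<lambda>i. norm (indicator (\<Union>j<i. ?B j) x - indicator (\<Union>i. ?B i) x :: complex)) \<longlonglongrightarrow> 0"
          by (simp add: tendsto_norm_zero_iff)
        then show "(\<lambda>i. enorm (\<lambda>x. (\<Sum>j<i. indicator (?B j) x) - indicator (\<Union>i. ?B i) x) x) \<longlonglongrightarrow> 0"
          unfolding eq using tendsto_ennrealI by force
      qed
      show "AE x in lborel. enorm (\<lambda>x. (\<Sum>j<i. indicator (?B j) x) - indicator (\<Union>i. ?B i) x) x \<le> indicator (box a b) x" for i
        unfolding eq by (intro AE_I2) (auto simp: indicator_def)
      show "\<rho> (indicator (box a b)) < top"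
        by (rule bounded) auto
    qed auto
    have fin: "N (indicator (\<Union>i. ?B i)) < top"
    proof -
      have "N (indicator (\<Union>i. ?B i)) \<le> \<rho> (indicator (box a b))"
        by (intro mono AE_I2) (auto simp: indicator_def)
      also have "\<dots> < top" by (rule bounded) auto
      finally show ?thesis .
    qed
    show ?case
      unfolding UN
      by (rule approximable_limit[OF _ fin approximable_sum[OF _ union.IH] dom]) auto
  qed
qed

text \<open>Simple functions cut off to growing boxes are approximable and converge to
  \<open>g\<close> pointwise. They can be chosen with norm at most twice that of \<open>g\<close>,
  which allows dominated convergence.\<close>

theorem mollifier_tendsto:
  fixes g :: "'a \<Rightarrow> complex"
  assumes g [measurable]: "g \<in> borel_measurable borel" and Ng: "N g < top"
  shows "(\<lambda>n. N (\<lambda>x. cconv (mollifier n) g x - g x)) \<longlonglongrightarrow> 0"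
proof -
  obtain F where F: "\<And>i. simple_function borel (F i)" "\<And>x. (\<lambda>i. F i x) \<longlonglongrightarrow> g x"
    "\<And>i x. norm (F i x) \<le> 2 * norm (g x)"
    using borel_measurable_implies_sequence_metric[OF g, of 0] by auto
  define B where "B i = box (- real i *\<^sub>R One) (real i *\<^sub>R One :: 'a)" for i
  define h where "h i x = (\<Sum>c\<in>range (F i). c * indicator (F i -` {c} \<inter> B i) x)" for i x
  have fin: "finite (range (F i))" for i
    using simple_functionD(1)[OF F(1)[of i]] by simp
  have h_eq: "h i x = (if x \<in> B i then F i x else 0)" for i x
  proof -
    have "h i x = (\<Sum>c\<in>range (F i). if c = F i x then (if x \<in> B i then F i x else 0) else 0)"
      unfolding h_def by (intro sum.cong) (auto simp: indicator_def)
    then show ?thesis using fin[of i] by (simp add: sum.delta)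
  qed
  have h_app: "h i \<in> approximable" for i
    unfolding h_def[abs_def] B_def
    using simple_functionD(2)[OF F(1)[of i]]
    by (intro approximable_sum[OF fin] approximable_cmult approximable_indicator) auto
  note [measurable] = approximableD(1)[OF h_app]
  have "(\<lambda>i. N (\<lambda>x. h i x - g x)) \<longlonglongrightarrow> 0"
  proof (rule dominated)
    show "AE x in lborel. (\<lambda>i. enorm (\<lambda>x. h i x - g x) x) \<longlonglongrightarrow> 0"
    proof (rule AE_I2)
      fix x :: 'a
      have "x \<in> (\<Union>i. B i)" unfolding B_def by (simp add: UN_box_eq_UNIV)
      then obtain k where "x \<in> B k" by auto
      moreover have "B k \<subseteq> B i" if "k \<le> i" for i
        using that unfolding B_def by (auto simp: subset_box)
      ultimately have "eventually (\<lambda>i. h i x = F i x) sequentially"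
        by (auto simp: h_eq eventually_sequentially)
      then have "(\<lambda>i. h i x) \<longlonglongrightarrow> g x"
        using F(2)[of x] by (simp add: tendsto_cong)
      then have "(\<lambda>i. norm (h i x - g x)) \<longlonglongrightarrow> 0"
        by (simp add: tendsto_norm_zero_iff LIM_zero_iff)
      then show "(\<lambda>i. enorm (\<lambda>x. h i x - g x) x) \<longlonglongrightarrow> 0"
        using tendsto_ennrealI by force
    qed
    \<comment> \<open>The 3 consists of 2 for the simple function and 1 for \<open>g\<close>;
      outside the box the error has the norm of \<open>g\<close>.\<close>
    show "AE x in lborel. enorm (\<lambda>x. h i x - g x) x \<le> enorm (\<lambda>x. 3 * g x) x" for i
    proof (intro AE_I2 ennreal_leI)
      show "norm (h i x - g x) \<le> norm (3 * g x)" for x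
        using F(3)[of i x] norm_triangle_ineq4[of "F i x" "g x"] by (auto simp: h_eq norm_mult)
    qed
    show "N (\<lambda>x. 3 * g x) < top"
      using Ng by (subst N_cmult) (auto simp: ennreal_mult_less_top)
  qed auto
  then show ?thesis
    using approximable_limit[of g h, OF g Ng h_app] by auto
qed

end

section \<open>Factorization\<close>

definition kernel :: "('a::euclidean_space \<Rightarrow> complex) \<Rightarrow> bool" where
  "kernel f \<longleftrightarrow> f \<in> borel_measurable borel \<and> (\<forall>x. x \<notin> cbox 0 One \<longrightarrow> f x = 0) \<and>
     (\<integral>\<^sup>+x. enorm f x \<partial>lborel) < top"

lemma kernelD:
  assumes "kernel f"
  shows "f \<in> borel_measurable borel" "x \<notin> cbox 0 One \<Longrightarrow> f x = 0" "(\<integral>\<^sup>+x. enorm f x \<partial>lborel) < top"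
  using assms by (auto simp: kernel_def)

lemma kernel_cmult: "kernel f \<Longrightarrow> kernel (\<lambda>x. c * f x)"
  by (auto simp: kernel_def norm_mult ennreal_mult nn_integral_cmult ennreal_mult_less_top)

lemma kernel_add:
  assumes f: "kernel f" and g: "kernel g" shows "kernel (\<lambda>x. f x + g x)"
proof -
  note [measurable] = kernelD(1)[OF f] kernelD(1)[OF g]
  have "(\<integral>\<^sup>+x. enorm (\<lambda>x. f x + g x) x \<partial>lborel) \<le> (\<integral>\<^sup>+x. enorm f x \<partial>lborel) + (\<integral>\<^sup>+x. enorm g x \<partial>lborel)"
    by (intro L1.N_le_add) auto
  also have "\<dots> < top" using kernelD(3)[OF f] kernelD(3)[OF g] by simp
  finally show ?thesis using kernelD(2)[OF f] kernelD(2)[OF g] by (simp add: kernel_def)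
qed

lemma kernel_diff: "kernel f \<Longrightarrow> kernel g \<Longrightarrow> kernel (\<lambda>x. f x - g x)"
  using kernel_add[of f "\<lambda>x. -1 * g x"] kernel_cmult[of g "-1"] by simp

lemma kernel_mollifier: "kernel (mollifier n)"
  by (auto simp: kernel_def L1.mol.e_outside L1.mol.e_fin)

context conv_module
begin

lemma AE_kernel_nconv_less_top:
  assumes "kernel f" "v \<in> borel_measurable borel" "\<rho> v < top"
  shows "AE x in lborel. nconv (enorm f) v x < top"
  using assms by (intro AE_nconv_less_top) (auto simp: kernel_def)

lemma AE_cconv_add_left:
  assumes "kernel f" "kernel f'" "g \<in> borel_measurable borel" "N g < top"
  shows "AE x in lborel. cconv (\<lambda>x. f x + f' x) g x = cconv f g x + cconv f' g x"
  using AE_kernel_nconv_less_top[OF assms(1), of "enorm g"] AE_kernel_nconv_less_top[OF assms(2), of "enorm g"] assms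
  by (auto elim!: eventually_elim2 intro!: cconv_add_left simp: kernelD(1))

lemma AE_cconv_add_right:
  assumes "kernel f" "g \<in> borel_measurable borel" "N g < top" "g' \<in> borel_measurable borel" "N g' < top"
  shows "AE x in lborel. cconv f (\<lambda>x. g x + g' x) x = cconv f g x + cconv f g' x"
  using AE_kernel_nconv_less_top[OF assms(1), of "enorm g"] AE_kernel_nconv_less_top[OF assms(1), of "enorm g'"] assms
  by (auto elim!: eventually_elim2 intro!: cconv_add_right simp: kernelD(1))

lemma N_cconv_less_top:
  assumes "kernel f" "g \<in> borel_measurable borel" "N g < top"
  shows "N (cconv f g) < top"
  using assms
  by (intro le_less_trans[OF N_cconv_le]) (auto simp: kernelD ennreal_mult_less_top)

lemma AE_cconv_diff_left:
  assumes "kernel f" "kernel f'" "g \<in> borel_measurable borel" "N g < top"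
  shows "AE x in lborel. cconv (\<lambda>x. f x - f' x) g x = cconv f g x - cconv f' g x"
  using AE_cconv_add_left[of f "\<lambda>x. -1 * f' x" g] assms cconv_cmult_left[of "-1" f' g] kernel_cmult[of f' "-1"]
  by simp

lemma AE_cconv_diff_right:
  assumes "kernel f" "g \<in> borel_measurable borel" "N g < top" "g' \<in> borel_measurable borel" "N g' < top"
  shows "AE x in lborel. cconv f (\<lambda>x. g x - g' x) x = cconv f g x - cconv f g' x"
  using AE_cconv_add_right[of f g "\<lambda>x. -1 * g' x"] assms cconv_cmult_right[of f "-1" g'] by simp

text \<open>Multiplies the measure \<open>(1 - a) ^ n \<delta> + F\<close> by
  \<open>(1 - a) \<delta> + a e\<close>. Two invariants make this repeatable: the total variation is
  at most 1, and \<open>F\<close> lives on the cube of side \<open>1 - (1/2) ^ n\<close>, which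
  leaves room for one more kernel of side at most \<open>(1/2) ^ Suc n\<close>.\<close>

lemma factorization_step:
  fixes F g h :: "'a \<Rightarrow> complex"
  assumes b: "0 \<le> b" "b \<le> 1" "K * b powr s \<le> 1 / 2" and a: "a = b / (1 + b)"
    and F [measurable]: "F \<in> borel_measurable borel"
    and F0: "\<And>x. x \<notin> cbox 0 ((1 - (1/2) ^ n) *\<^sub>R One) \<Longrightarrow> F x = 0"
    and F1: "(\<integral>\<^sup>+x. enorm F x \<partial>lborel) + ennreal ((1 - a) ^ n) \<le> 1"
    and g [measurable]: "g \<in> borel_measurable borel" and Ng: "N g < top"
    and eq: "AE x in lborel. complex_of_real ((1 - a) ^ n) * g x + cconv F g x = h x"
  obtains F' g' where "F' \<in> borel_measurable borel"
    "\<And>x. x \<notin> cbox 0 ((1 - (1/2) ^ Suc n) *\<^sub>R One) \<Longrightarrow> F' x = 0"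
    "(\<integral>\<^sup>+x. enorm F' x \<partial>lborel) + ennreal ((1 - a) ^ Suc n) \<le> 1"
    "g' \<in> borel_measurable borel" "N g' < top"
    "AE x in lborel. complex_of_real ((1 - a) ^ Suc n) * g' x + cconv F' g' x = h x"
    "(\<integral>\<^sup>+x. enorm (\<lambda>x. F' x - F x) x \<partial>lborel) \<le> ennreal ((1/2) ^ n) + ennreal ((1 - a) ^ n)"
    "N (\<lambda>x. g' x - g x) \<le> ennreal ((1/2) ^ n)"
proof -
  define \<alpha> where "\<alpha> = (1 - a) ^ n"
  have a01: "0 \<le> a" "a < 1" unfolding a using b by auto
  have \<alpha>: "0 \<le> \<alpha>" using a01 by (simp add: \<alpha>_def)
  have "(\<integral>\<^sup>+x. enorm F x \<partial>lborel) \<le> (\<integral>\<^sup>+x. enorm F x \<partial>lborel) + ennreal ((1 - a) ^ n)"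
    by simp
  also note F1
  finally have F_le: "(\<integral>\<^sup>+x. enorm F x \<partial>lborel) \<le> 1" .
  then have F_fin: "(\<integral>\<^sup>+x. enorm F x \<partial>lborel) < top" by (rule le_less_trans) simp
  have "cbox 0 ((1 - (1/2) ^ n) *\<^sub>R One) \<subseteq> cbox (0::'a) One"
    by (auto simp: subset_box)
  then have F: "kernel F"
    using F0 F_fin by (auto simp: kernel_def)
  \<comment> \<open>The index \<open>m\<close> depends on both \<open>F\<close> and
    \<open>g\<close>: the mollifier must nearly fix \<open>F\<close> in L1 and \<open>g\<close> in
    terms of \<open>N\<close>, and its cube must fit. The exponent for \<open>g\<close> is
    \<open>Suc n\<close> because the resolvent costs a factor 2.\<close>
  have "eventually (\<lambda>m. (\<integral>\<^sup>+x. enorm (\<lambda>x. cconv (mollifier m) F x - F x) x \<partial>lborel) < ennreal ((1/2) ^ n)) sequentially"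
    by (rule order_tendstoD(2)[OF L1.mollifier_tendsto[OF _ F_fin]]) auto
  moreover have "eventually (\<lambda>m. N (\<lambda>x. cconv (mollifier m) g x - g x) < ennreal ((1/2) ^ Suc n)) sequentially"
    by (rule order_tendstoD(2)[OF mollifier_tendsto[OF g Ng]]) auto
  moreover have "eventually (\<lambda>m. Suc n \<le> m) sequentially"
    by (rule eventually_ge_at_top)
  ultimately have "eventually (\<lambda>m. (\<integral>\<^sup>+x. enorm (\<lambda>x. cconv (mollifier m) F x - F x) x \<partial>lborel) < ennreal ((1/2) ^ n) \<and>
      N (\<lambda>x. cconv (mollifier m) g x - g x) < ennreal ((1/2) ^ Suc n) \<and> Suc n \<le> m) sequentially"
    by (intro eventually_conj)
  then obtain m where m: "(\<integral>\<^sup>+x. enorm (\<lambda>x. cconv (mollifier m) F x - F x) x \<partial>lborel) < ennreal ((1/2) ^ n)"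
    "N (\<lambda>x. cconv (mollifier m) g x - g x) < ennreal ((1/2) ^ Suc n)" "Suc n \<le> m"
    by (auto simp: eventually_sequentially)
  let ?e = "mollifier m :: 'a \<Rightarrow> complex"
  obtain g' where g' [measurable]: "g' \<in> borel_measurable borel" and Ng': "N g' < top"
    and diff: "N (\<lambda>x. g' x - g x) \<le> 2 * N (\<lambda>x. cconv ?e g x - g x)"
    and res: "AE x in lborel. complex_of_real (1 - a) * g' x + complex_of_real a * cconv ?e g' x = g x"
    by (rule mol.resolvent[OF g Ng b a, of m]) (rule that)
  \<comment> \<open>The product without its point mass, where \<open>\<alpha>\<close> is the mass at
    0 so far: \<open>F\<close> meets both terms of the new factor, and the old point mass meets
    \<open>a e\<close>.\<close>
  define F' where "F' x = complex_of_real (1 - a) * F x + complex_of_real a * cconv ?e F x + complex_of_real (a * \<alpha>) * ?e x" for x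
  have [measurable]: "F' \<in> borel_measurable borel"
    unfolding F'_def[abs_def] by measurable
  have dy: "(1/2::real) ^ m \<le> (1/2) ^ Suc n"
    using m(3) by (intro power_decreasing) auto
  have dy1: "(1/2::real) ^ Suc n \<le> 1 / 2"
    using power_decreasing[of 1 "Suc n" "1/2::real"] by simp
  let ?C = "cbox 0 ((1 - (1/2) ^ Suc n) *\<^sub>R One) :: 'a set"
  have eF0: "cconv ?e F x = 0" if "x \<notin> ?C" for x
  proof (rule cconv_outside[where C="?C"])
    fix c d assume "c \<in> cbox (0::'a) ((1/2) ^ m *\<^sub>R One)" "d \<in> cbox (0::'a) ((1 - (1/2) ^ n) *\<^sub>R One)"
    then show "c + d \<in> ?C"
      using dy by (force simp: mem_box inner_add_left)
  qed (use F0 mollifier_outside that in auto)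
  have e0: "?e x = 0" if "x \<notin> ?C" for x
  proof (rule mollifier_outside)
    have "cbox 0 ((1/2) ^ m *\<^sub>R One) \<subseteq> ?C"
      using dy dy1 by (auto simp: subset_box)
    then show "x \<notin> cbox 0 ((1/2) ^ m *\<^sub>R One)" using that by auto
  qed
  have "cbox 0 ((1 - (1/2) ^ n) *\<^sub>R One) \<subseteq> ?C"
    by (auto simp: subset_box)
  then have F'0: "F' x = 0" if "x \<notin> ?C" for x
    using that e0 eF0 F0 by (auto simp: F'_def)
  have "?C \<subseteq> cbox (0::'a) One"
    by (auto simp: subset_box)
  then have eF: "kernel (cconv ?e F)"
    using eF0 L1.N_cconv_less_top[OF kernel_mollifier _ F_fin, of m] by (auto simp: kernel_def)
  have eF_le: "(\<integral>\<^sup>+x. enorm (cconv ?e F) x \<partial>lborel) \<le> (\<integral>\<^sup>+x. enorm F x \<partial>lborel)"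
    using L1.mol.N_kernel_le[of F m] by simp
  have scale: "(\<integral>\<^sup>+x. enorm (\<lambda>x. complex_of_real c * f x) x \<partial>lborel) = ennreal c * (\<integral>\<^sup>+x. enorm f x \<partial>lborel)"
    if "0 \<le> c" "f \<in> borel_measurable borel" for c f
    using L1.N_cmult[of f "complex_of_real c"] that by simp
  show thesis
  proof
    have "(\<integral>\<^sup>+x. enorm F' x \<partial>lborel) \<le>
        (\<integral>\<^sup>+x. enorm (\<lambda>x. complex_of_real (1 - a) * F x + complex_of_real a * cconv ?e F x) x \<partial>lborel)
        + (\<integral>\<^sup>+x. enorm (\<lambda>x. complex_of_real (a * \<alpha>) * ?e x) x \<partial>lborel)"
      by (intro L1.N_le_add) (auto simp: F'_def)
    also have "\<dots> \<le> ((\<integral>\<^sup>+x. enorm (\<lambda>x. complex_of_real (1 - a) * F x) x \<partial>lborel)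
        + (\<integral>\<^sup>+x. enorm (\<lambda>x. complex_of_real a * cconv ?e F x) x \<partial>lborel))
        + (\<integral>\<^sup>+x. enorm (\<lambda>x. complex_of_real (a * \<alpha>) * ?e x) x \<partial>lborel)"
      by (intro add_right_mono L1.N_le_add) auto
    also have "\<dots> \<le> (ennreal (1 - a) * (\<integral>\<^sup>+x. enorm F x \<partial>lborel) + ennreal a * (\<integral>\<^sup>+x. enorm F x \<partial>lborel)) + ennreal (a * \<alpha>)"
      using a01 \<alpha> eF_le
      by (subst (1 2 3) scale) (auto simp: nn_integral_mollifier intro!: add_mono mult_left_mono)
    also have "\<dots> = (ennreal (1 - a) + ennreal a) * (\<integral>\<^sup>+x. enorm F x \<partial>lborel) + ennreal (a * \<alpha>)"
      by (simp only: distrib_right)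
    also have "ennreal (1 - a) + ennreal a = 1"
      using a01 by (simp flip: ennreal_plus)
    finally have "(\<integral>\<^sup>+x. enorm F' x \<partial>lborel) + ennreal ((1 - a) ^ Suc n) \<le>
        (\<integral>\<^sup>+x. enorm F x \<partial>lborel) + ennreal (a * \<alpha>) + ennreal ((1 - a) * \<alpha>)"
      by (simp add: \<alpha>_def add_right_mono)
    also have "\<dots> = (\<integral>\<^sup>+x. enorm F x \<partial>lborel) + ennreal (a * \<alpha> + (1 - a) * \<alpha>)"
      using a01 \<alpha> by (simp add: add.assoc flip: ennreal_plus)
    also have "a * \<alpha> + (1 - a) * \<alpha> = \<alpha>" by (simp add: algebra_simps)
    finally show "(\<integral>\<^sup>+x. enorm F' x \<partial>lborel) + ennreal ((1 - a) ^ Suc n) \<le> 1"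
      using F1 by (simp add: \<alpha>_def)
    \<comment> \<open>The difference is \<open>a\<close> times the change of \<open>F\<close> under
      the mollifier, plus \<open>a * \<alpha>\<close> times the mollifier. The former is small by
      the choice of \<open>m\<close>, the latter because the point mass decays.\<close>
    have "(\<integral>\<^sup>+x. enorm (\<lambda>x. F' x - F x) x \<partial>lborel) \<le>
        (\<integral>\<^sup>+x. enorm (\<lambda>x. complex_of_real a * (cconv ?e F x - F x)) x \<partial>lborel)
        + (\<integral>\<^sup>+x. enorm (\<lambda>x. complex_of_real (a * \<alpha>) * ?e x) x \<partial>lborel)"
      by (intro L1.N_le_add) (auto simp: F'_def algebra_simps)
    also have "\<dots> = ennreal a * (\<integral>\<^sup>+x. enorm (\<lambda>x. cconv ?e F x - F x) x \<partial>lborel) + ennreal (a * \<alpha>)"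
      using a01 \<alpha> by (subst (1 2) scale) (auto simp: nn_integral_mollifier)
    also have "\<dots> \<le> ennreal 1 * (\<integral>\<^sup>+x. enorm (\<lambda>x. cconv ?e F x - F x) x \<partial>lborel) + ennreal (1 * \<alpha>)"
      using a01 \<alpha> by (intro add_mono mult_right_mono ennreal_leI) auto
    also have "\<dots> \<le> ennreal ((1/2) ^ n) + ennreal ((1 - a) ^ n)"
      using m(1) by (auto simp: \<alpha>_def intro!: add_right_mono)
    finally show "(\<integral>\<^sup>+x. enorm (\<lambda>x. F' x - F x) x \<partial>lborel) \<le> ennreal ((1/2) ^ n) + ennreal ((1 - a) ^ n)" .
    have "2 * N (\<lambda>x. cconv ?e g x - g x) \<le> ennreal 2 * ennreal ((1/2) ^ Suc n)"
      using m(2) by (intro mult_mono) auto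
    also have "\<dots> = ennreal ((1/2) ^ n)"
      by (subst ennreal_mult[symmetric]) auto
    finally show "N (\<lambda>x. g' x - g x) \<le> ennreal ((1/2) ^ n)"
      using diff by (rule order.trans[rotated])
    \<comment> \<open>Commutativity enters here: convolving \<open>g'\<close> with
      \<open>cconv ?e F\<close> amounts to convolving \<open>cconv ?e g'\<close> with
      \<open>F\<close>. Hence inserting the resolvent equation for \<open>g\<close> into the old
      equation produces the new one.\<close>
    show "AE x in lborel. complex_of_real ((1 - a) ^ Suc n) * g' x + cconv F' g' x = h x"
    proof -
      have Neg': "N (cconv ?e g') < top"
        by (rule mol.N_kernel_less_top[OF g' Ng'])
      have "\<rho> (nconv (enorm ?e) (enorm g')) < top"
        using Ng' mol.e_fin[of m] by (intro rho_nconv_less_top) (auto simp: mol.e_outside)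
      then have "AE x in lborel. nconv (enorm F) (nconv (enorm ?e) (enorm g')) x < top"
        by (intro AE_kernel_nconv_less_top F) auto
      then have 1: "AE x in lborel. cconv (cconv ?e F) g' x = cconv F (cconv ?e g') x"
        unfolding cconv_commute[OF mollifier_measurable \<open>F \<in> _\<close>]
        by eventually_elim (intro cconv_assoc, auto)
      have "AE x in lborel. cconv F' g' x =
          cconv (\<lambda>x. complex_of_real (1 - a) * F x + complex_of_real a * cconv ?e F x) g' x + cconv (\<lambda>x. complex_of_real (a * \<alpha>) * ?e x) g' x"
        unfolding F'_def[abs_def]
        by (intro AE_cconv_add_left kernel_add kernel_cmult F eF kernel_mollifier g' Ng')
      moreover have "AE x in lborel. cconv (\<lambda>x. complex_of_real (1 - a) * F x + complex_of_real a * cconv ?e F x) g' x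
          = cconv (\<lambda>x. complex_of_real (1 - a) * F x) g' x + cconv (\<lambda>x. complex_of_real a * cconv ?e F x) g' x"
        by (intro AE_cconv_add_left kernel_add kernel_cmult F eF kernel_mollifier g' Ng')
      ultimately have 2: "AE x in lborel. cconv F' g' x = complex_of_real (1 - a) * cconv F g' x +
          complex_of_real a * cconv (cconv ?e F) g' x + complex_of_real (a * \<alpha>) * cconv ?e g' x"
        by eventually_elim (simp add: cconv_cmult_left)
      have 3: "cconv F g = cconv F (\<lambda>x. complex_of_real (1 - a) * g' x + complex_of_real a * cconv ?e g' x)"
        by (rule cconv_cong_AE_right) (use res in \<open>auto elim!: eventually_mono\<close>)
      have "AE x in lborel. cconv F g x = cconv F (\<lambda>x. complex_of_real (1 - a) * g' x) x + cconv F (\<lambda>x. complex_of_real a * cconv ?e g' x) x"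
        unfolding 3 using Ng' Neg'
        by (intro AE_cconv_add_right F) (auto simp: N_cmult ennreal_mult_less_top simp del: of_real_diff)
      then have 4: "AE x in lborel. cconv F g x = complex_of_real (1 - a) * cconv F g' x + complex_of_real a * cconv F (cconv ?e g') x"
        by (simp only: cconv_cmult_right)
      from 1 2 4 res eq show ?thesis
      proof eventually_elim
        fix x
        assume 1: "cconv (cconv ?e F) g' x = cconv F (cconv ?e g') x"
          and 2: "cconv F' g' x = complex_of_real (1 - a) * cconv F g' x +
            complex_of_real a * cconv (cconv ?e F) g' x + complex_of_real (a * \<alpha>) * cconv ?e g' x"
          and 4: "cconv F g x = complex_of_real (1 - a) * cconv F g' x + complex_of_real a * cconv F (cconv ?e g') x"
          and res: "complex_of_real (1 - a) * g' x + complex_of_real a * cconv ?e g' x = g x"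
          and eq: "complex_of_real ((1 - a) ^ n) * g x + cconv F g x = h x"
        show "complex_of_real ((1 - a) ^ Suc n) * g' x + cconv F' g' x = h x"
          unfolding 2 1 eq[symmetric] 4 res[symmetric] by (simp add: \<alpha>_def algebra_simps)
      qed
    qed
  qed (use F'0 Ng' in auto)
qed

theorem factorization:
  fixes h :: "'a \<Rightarrow> complex"
  assumes h [measurable]: "h \<in> borel_measurable borel" and Nh: "N h < top"
  obtains f g where "kernel f" "g \<in> borel_measurable borel" "N g < top" "AE x in lborel. cconv f g x = h x"
proof -
  \<comment> \<open>Chosen to attain the bound \<open>K * b powr s = 1 / 2\<close> of the Neumann
    series, uniformly for all mollifiers.\<close>
  define b where "b = (1 / (2 * K)) powr (1 / s)"
  define a where "a = b / (1 + b)"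
  have "K * b powr s = 1 / 2"
    using s_pos K_ge by (simp add: b_def powr_powr)
  moreover have "b \<le> 1"
    unfolding b_def using s_pos K_ge by (intro powr_le1) auto
  moreover have b_pos: "0 < b"
    unfolding b_def using K_ge by (subst powr_gt_zero) auto
  ultimately have b: "0 \<le> b" "b \<le> 1" "K * b powr s \<le> 1 / 2" by auto
  have a01: "0 < a" "a < 1" unfolding a_def using b_pos by auto
  define P where "P n x \<longleftrightarrow> (case x of (F, g) \<Rightarrow> F \<in> borel_measurable borel \<and>
    (\<forall>x. x \<notin> cbox 0 ((1 - (1/2) ^ n) *\<^sub>R One) \<longrightarrow> F x = 0) \<and>
    (\<integral>\<^sup>+x. enorm F x \<partial>lborel) + ennreal ((1 - a) ^ n) \<le> 1 \<and>
    g \<in> borel_measurable borel \<and> N g < top \<and>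
    (AE x in lborel. complex_of_real ((1 - a) ^ n) * g x + cconv F g x = h x))"
    for n and x :: "('a \<Rightarrow> complex) \<times> ('a \<Rightarrow> complex)"
  \<comment> \<open>Both bounds are summable in \<open>n\<close>, since \<open>a\<close> is
    positive; this makes the two sequences converge.\<close>
  define Q where "Q n x y \<longleftrightarrow>
    (\<integral>\<^sup>+t. enorm (\<lambda>t. fst y t - fst x t) t \<partial>lborel) \<le> ennreal ((1/2) ^ n) + ennreal ((1 - a) ^ n) \<and>
    N (\<lambda>t. snd y t - snd x t) \<le> ennreal ((1/2) ^ n)"
    for n and x y :: "('a \<Rightarrow> complex) \<times> ('a \<Rightarrow> complex)"
  have "\<exists>S. \<forall>n. P n (S n) \<and> Q n (S n) (S (Suc n))"
  proof (rule dependent_nat_choice)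
    \<comment> \<open>The empty product is the point mass at 0.\<close>
    have "P 0 (\<lambda>x. 0, h)"
      using Nh by (simp add: P_def cconv_def)
    then show "\<exists>x. P 0 x" by blast
    fix x n assume "P n x"
    then obtain F g where x: "x = (F, g)" and "F \<in> borel_measurable borel"
      "\<And>x. x \<notin> cbox 0 ((1 - (1/2) ^ n) *\<^sub>R One) \<Longrightarrow> F x = 0"
      "(\<integral>\<^sup>+x. enorm F x \<partial>lborel) + ennreal ((1 - a) ^ n) \<le> 1"
      "g \<in> borel_measurable borel" "N g < top"
      "AE x in lborel. complex_of_real ((1 - a) ^ n) * g x + cconv F g x = h x"
      unfolding P_def by (cases x) auto
    from factorization_step[OF b a_def this(2-)] obtain F' g' where
      "F' \<in> borel_measurable borel"
      "\<And>x. x \<notin> cbox 0 ((1 - (1/2) ^ Suc n) *\<^sub>R One) \<Longrightarrow> F' x = 0"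
      "(\<integral>\<^sup>+x. enorm F' x \<partial>lborel) + ennreal ((1 - a) ^ Suc n) \<le> 1"
      "g' \<in> borel_measurable borel" "N g' < top"
      "AE x in lborel. complex_of_real ((1 - a) ^ Suc n) * g' x + cconv F' g' x = h x"
      "(\<integral>\<^sup>+x. enorm (\<lambda>x. F' x - F x) x \<partial>lborel) \<le> ennreal ((1/2) ^ n) + ennreal ((1 - a) ^ n)"
      "N (\<lambda>x. g' x - g x) \<le> ennreal ((1/2) ^ n)"
      by blast
    then have "P (Suc n) (F', g') \<and> Q n x (F', g')"
      unfolding P_def Q_def x by (simp del: power_Suc)
    then show "\<exists>y. P (Suc n) y \<and> Q n x y" ..
  qed
  then obtain S where S: "\<And>n. P n (S n)" "\<And>n. Q n (S n) (S (Suc n))" by blast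
  define F where "F n = fst (S n)" for n
  define G where "G n = snd (S n)" for n
  have S_eq: "S n = (F n, G n)" for n by (simp add: F_def G_def)
  have Fm [measurable]: "F n \<in> borel_measurable borel" and Gm [measurable]: "G n \<in> borel_measurable borel"
    and F0: "x \<notin> cbox 0 ((1 - (1/2) ^ n) *\<^sub>R One) \<Longrightarrow> F n x = 0"
    and F1: "(\<integral>\<^sup>+x. enorm (F n) x \<partial>lborel) + ennreal ((1 - a) ^ n) \<le> 1"
    and NG: "N (G n) < top"
    and FG: "AE x in lborel. complex_of_real ((1 - a) ^ n) * G n x + cconv (F n) (G n) x = h x" for n x
    using S(1)[of n] unfolding S_eq P_def by auto
  have F_step: "(\<integral>\<^sup>+x. enorm (\<lambda>x. F (Suc n) x - F n x) x \<partial>lborel) \<le> ennreal ((1/2) ^ n) + ennreal ((1 - a) ^ n)"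
    and G_step: "N (\<lambda>x. G (Suc n) x - G n x) \<le> ennreal ((1/2) ^ n)" for n
    using S(2)[of n] unfolding S_eq Q_def by auto
  have geo: "(\<Sum>n. ennreal (c ^ n)) < top" if "0 \<le> c" "c < 1" for c :: real
  proof -
    have "(\<Sum>n. ennreal (c ^ n)) = ennreal (1 / (1 - c))"
      by (rule suminf_ennreal_eq) (use that geometric_sums[of c] in auto)
    then show ?thesis by simp
  qed
  have "(\<Sum>n. (\<integral>\<^sup>+x. enorm (\<lambda>x. F (Suc n) x - F n x) x \<partial>lborel)) \<le> (\<Sum>n. ennreal ((1/2) ^ n) + ennreal ((1 - a) ^ n))"
    by (intro suminf_le F_step) auto
  also have "\<dots> = (\<Sum>n. ennreal ((1/2) ^ n)) + (\<Sum>n. ennreal ((1 - a) ^ n))"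
    by (rule suminf_add[symmetric]) auto
  also have "\<dots> < top"
    using geo[of "1/2"] geo[of "1 - a"] a01 by (simp only: ennreal_add_less_top)
  finally have F_sum: "(\<Sum>n. (\<integral>\<^sup>+x. enorm (\<lambda>x. F (Suc n) x - F n x) x \<partial>lborel)) < top" .
  have G_sum: "(\<Sum>n. N (\<lambda>x. G (Suc n) x - G n x)) < top"
    by (rule le_less_trans[OF suminf_le[OF G_step] geo]) auto
  have F_kernel: "kernel (F n)" for n
  proof -
    have "(\<integral>\<^sup>+x. enorm (F n) x \<partial>lborel) \<le> (\<integral>\<^sup>+x. enorm (F n) x \<partial>lborel) + ennreal ((1 - a) ^ n)"
      by simp
    also note F1
    finally have "(\<integral>\<^sup>+x. enorm (F n) x \<partial>lborel) < top" by (rule le_less_trans) simp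
    moreover have "cbox 0 ((1 - (1/2) ^ n) *\<^sub>R One) \<subseteq> cbox (0::'a) One"
      by (auto simp: subset_box)
    ultimately show ?thesis using F0 by (auto simp: kernel_def)
  qed
  have dF: "(\<lambda>x. F (Suc n) x - F n x) \<in> borel_measurable borel"
    and dG: "(\<lambda>x. G (Suc n) x - G n x) \<in> borel_measurable borel" for n
    by measurable
  let ?TF = "\<lambda>m. \<Sum>j. (\<integral>\<^sup>+x. enorm (\<lambda>x. F (Suc (j + m)) x - F (j + m) x) x \<partial>lborel)"
  let ?TG = "\<lambda>m. \<Sum>j. N (\<lambda>x. G (Suc (j + m)) x - G (j + m) x)"
  obtain z where [measurable]: "z \<in> borel_measurable borel"
    and z: "\<And>m. (\<integral>\<^sup>+x. enorm (\<lambda>x. z x - (\<Sum>j<m. F (Suc j) x - F j x)) x \<partial>lborel) \<le> ?TF m"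
    by (rule L1.N_complete[OF dF F_sum]) (rule that)
  obtain w where [measurable]: "w \<in> borel_measurable borel"
    and w: "\<And>m. N (\<lambda>x. w x - (\<Sum>j<m. G (Suc j) x - G j x)) \<le> ?TG m"
    by (rule N_complete[OF dG G_sum]) (rule that)
  \<comment> \<open>The limit is controlled only almost everywhere, whereas \<open>kernel\<close>
    asks for zeros at every point outside the cube. The cut-off does not increase the error, as
    every \<open>F m\<close> vanishes there.\<close>
  define f where "f x = indicator (cbox 0 One) x * (F 0 x + z x)" for x
  define g where "g x = G 0 x + w x" for x
  have [measurable]: "f \<in> borel_measurable borel" "g \<in> borel_measurable borel"
    unfolding f_def[abs_def] g_def[abs_def] by measurable
  have tele_F: "(\<Sum>j<m. F (Suc j) x - F j x) = F m x - F 0 x"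
    and tele_G: "(\<Sum>j<m. G (Suc j) x - G j x) = G m x - G 0 x" for m x
    by (rule sum_lessThan_telescope)+
  have f_F: "(\<integral>\<^sup>+x. enorm (\<lambda>x. f x - F m x) x \<partial>lborel) \<le> ?TF m" for m
  proof -
    have "enorm (\<lambda>x. f x - F m x) x \<le> enorm (\<lambda>x. z x - (\<Sum>j<m. F (Suc j) x - F j x)) x" for x
      using kernelD(2)[OF F_kernel, of x m]
      by (cases "x \<in> cbox 0 One") (auto simp: f_def tele_F algebra_simps)
    then show ?thesis
      by (rule order.trans[OF nn_integral_mono z[of m]])
  qed
  have g_G: "N (\<lambda>x. g x - G m x) \<le> ?TG m" for m
  proof -
    have "g x - G m x = w x - (\<Sum>j<m. G (Suc j) x - G j x)" for x
      unfolding tele_G by (simp add: g_def)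
    then show ?thesis
      using w[of m] by (simp only:)
  qed
  have TF: "?TF \<longlonglongrightarrow> 0"
    by (rule tendsto_suminf_tail_0[OF F_sum])
  have TG: "?TG \<longlonglongrightarrow> 0"
    by (rule tendsto_suminf_tail_0[OF G_sum])
  have f: "kernel f"
  proof -
    have "(\<integral>\<^sup>+x. enorm f x \<partial>lborel) \<le> (\<integral>\<^sup>+x. enorm (\<lambda>x. f x - F 0 x) x \<partial>lborel) + (\<integral>\<^sup>+x. enorm (F 0) x \<partial>lborel)"
      by (intro L1.N_le_add) auto
    also have "\<dots> < top"
      using le_less_trans[OF f_F[of 0]] F_sum kernelD(3)[OF F_kernel[of 0]] by simp
    finally show ?thesis by (simp add: kernel_def f_def)
  qed
  have Ng: "N g < top"
  proof -
    have "N g \<le> N (\<lambda>x. g x - G 0 x) + N (G 0)"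
      by (intro N_le_add) auto
    also have "\<dots> < top"
      using le_less_trans[OF g_G[of 0]] G_sum NG[of 0] by simp
    finally show ?thesis .
  qed
  define r where "r x = h x - cconv f g x" for x
  have [measurable]: "r \<in> borel_measurable borel"
    unfolding r_def[abs_def] by measurable
  \<comment> \<open>The three summands bound the three parts of the defect: the point mass acting on
    \<open>G m\<close>, the kernel \<open>F m\<close> acting on \<open>G m - g\<close>, and
    \<open>F m - f\<close> acting on \<open>g\<close>. The first tends to 0 because
    \<open>N (G m)\<close> is at most \<open>N g + ?TG m\<close>, the second because every
    \<open>F m\<close> has mass at most 1.\<close>
  define B where "B m = ennpowr (ennreal ((1 - a) ^ m)) s * (N g + ?TG m) + (ennreal K * ?TG m + ennreal K * ennpowr (?TF m) s * N g)" for m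
  have "N r \<le> B m" for m
  proof -
    let ?\<alpha> = "complex_of_real ((1 - a) ^ m)"
    let ?d = "\<lambda>x. G m x - g x" and ?D = "\<lambda>x. F m x - f x"
    have Nd: "N ?d \<le> ?TG m" using g_G[of m] by (simp add: norm_minus_commute)
    have D: "kernel ?D" by (intro kernel_diff F_kernel f)
    have 1: "AE x in lborel. cconv (F m) ?d x = cconv (F m) (G m) x - cconv (F m) g x"
      by (intro AE_cconv_diff_right F_kernel NG Ng) auto
    have 2: "AE x in lborel. cconv ?D g x = cconv (F m) g x - cconv f g x"
      by (intro AE_cconv_diff_left F_kernel f Ng) auto
    from FG[of m] 1 2 have "AE x in lborel. r x = ?\<alpha> * G m x + (cconv (F m) ?d x + cconv ?D g x)"
    proof eventually_elim
      fix x
      assume h: "?\<alpha> * G m x + cconv (F m) (G m) x = h x"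
        and 1: "cconv (F m) ?d x = cconv (F m) (G m) x - cconv (F m) g x"
        and 2: "cconv ?D g x = cconv (F m) g x - cconv f g x"
      show "r x = ?\<alpha> * G m x + (cconv (F m) ?d x + cconv ?D g x)"
        unfolding r_def h[symmetric] 1 2 by simp
    qed
    then have "N r \<le> N (\<lambda>x. ?\<alpha> * G m x) + N (\<lambda>x. cconv (F m) ?d x + cconv ?D g x)"
      by (intro N_le_add) auto
    moreover have "N (\<lambda>x. cconv (F m) ?d x + cconv ?D g x) \<le> N (cconv (F m) ?d) + N (cconv ?D g)"
      by (intro N_le_add) auto
    moreover have "N (\<lambda>x. ?\<alpha> * G m x) \<le> ennpowr (ennreal ((1 - a) ^ m)) s * (N g + ?TG m)"
    proof -
      have "N (G m) \<le> N g + N ?d" by (intro N_le_add) auto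
      also have "\<dots> \<le> N g + ?TG m" by (intro add_left_mono Nd)
      finally show ?thesis
        using a01 by (subst N_cmult) (auto simp: ennpowr_ennreal norm_power intro!: mult_left_mono simp del: of_real_power of_real_diff)
    qed
    moreover have "N (cconv (F m) ?d) \<le> ennreal K * ?TG m"
    proof -
      have "(\<integral>\<^sup>+x. enorm (F m) x \<partial>lborel) \<le> (\<integral>\<^sup>+x. enorm (F m) x \<partial>lborel) + ennreal ((1 - a) ^ m)"
        by simp
      also note F1
      finally have le1: "(\<integral>\<^sup>+x. enorm (F m) x \<partial>lborel) \<le> 1" .
      have "N (cconv (F m) ?d) \<le> ennreal K * ennpowr (\<integral>\<^sup>+x. enorm (F m) x \<partial>lborel) s * N ?d"
        using kernelD[OF F_kernel[of m]] by (intro N_cconv_le) auto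
      also have "\<dots> \<le> ennreal K * 1 * ?TG m"
        using ennpowr_mono[OF _ le1, of s] s_pos by (intro mult_mono Nd) auto
      finally show ?thesis by simp
    qed
    moreover have "N (cconv ?D g) \<le> ennreal K * ennpowr (?TF m) s * N g"
    proof -
      have "(\<integral>\<^sup>+x. enorm ?D x \<partial>lborel) \<le> ?TF m"
        using f_F[of m] by (simp add: norm_minus_commute)
      from ennpowr_mono[OF _ this, of s] have le: "ennpowr (\<integral>\<^sup>+x. enorm ?D x \<partial>lborel) s \<le> ennpowr (?TF m) s"
        using s_pos by simp
      have "N (cconv ?D g) \<le> ennreal K * ennpowr (\<integral>\<^sup>+x. enorm ?D x \<partial>lborel) s * N g"
        using kernelD[OF D] by (intro N_cconv_le) auto
      also have "\<dots> \<le> ennreal K * ennpowr (?TF m) s * N g"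
        by (intro mult_right_mono mult_left_mono le) auto
      finally show ?thesis .
    qed
    ultimately show ?thesis
      unfolding B_def by (meson add_mono order.trans)
  qed
  moreover have "B \<longlonglongrightarrow> 0"
  proof -
    have "(\<lambda>m. (1 - a) ^ m) \<longlonglongrightarrow> 0"
      using a01 by (intro LIMSEQ_power_zero) auto
    then have "(\<lambda>m. ennreal ((1 - a) ^ m)) \<longlonglongrightarrow> 0"
      using tendsto_ennrealI by force
    then have "(\<lambda>m. ennpowr (ennreal ((1 - a) ^ m)) s) \<longlonglongrightarrow> 0"
      using tendsto_ennpowr[OF s_pos] by fastforce
    moreover have "(\<lambda>m. ennpowr (?TF m) s) \<longlonglongrightarrow> 0"
      using tendsto_ennpowr[OF s_pos TF] by simp
    ultimately have "B \<longlonglongrightarrow> 0 * (N g + 0) + (ennreal K * 0 + ennreal K * 0 * N g)"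
      unfolding B_def using TG Ng by (intro tendsto_add tendsto_mult_ennreal tendsto_const) auto
    then show ?thesis by simp
  qed
  ultimately have "N r \<le> 0"
    by (intro LIMSEQ_le_const[of B]) auto
  then have "AE x in lborel. r x = 0"
    using eq_0[of "enorm r"] by simp
  then have "AE x in lborel. cconv f g x = h x"
    by eventually_elim (simp add: r_def)
  with f Ng show thesis by (intro that) auto
qed

end

section \<open>Wiener amalgam norms as convolution modules\<close>

text \<open>\<open>unit_cube_at\<close> is built from the vector \<open>1\<close>, the modules use
  the sum of the basis.\<close>

lemma One_vec_eq: "(One :: real ^ 'n) = 1"
proof -
  have "(One :: real ^ 'n) \<bullet> axis i 1 = 1" for i
    using inner_sum_left_Basis[of "axis i 1 :: real ^ 'n" "\<lambda>_. 1"] by (simp add: axis_in_Basis_iff)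
  then show ?thesis by (simp add: vec_eq_iff inner_axis)
qed

lemma mem_unit_cube_at:
  "x \<in> unit_cube_at k \<longleftrightarrow> (\<forall>i. real_of_int (k $ i) \<le> x $ i \<and> x $ i \<le> real_of_int (k $ i) + 1)"
proof
  assume R: "\<forall>i. real_of_int (k $ i) \<le> x $ i \<and> x $ i \<le> real_of_int (k $ i) + 1"
  have "x = (\<chi> i. real_of_int (k $ i)) + (x - (\<chi> i. real_of_int (k $ i)))" by simp
  moreover have "x - (\<chi> i. real_of_int (k $ i)) \<in> cbox 0 1"
    using R by (auto simp: mem_box_cart algebra_simps)
  ultimately show "x \<in> unit_cube_at k"
    unfolding unit_cube_at_def by blast
qed (auto simp: unit_cube_at_def mem_box_cart)

lemma unit_cube_at_borel [measurable]: "unit_cube_at k \<in> sets borel"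
proof -
  have "closed (unit_cube_at k)"
    unfolding unit_cube_at_def by (intro closed_translation closed_cbox)
  then show ?thesis by simp
qed

lemma ex_unit_cube_at: "\<exists>k. x \<in> unit_cube_at k"
proof
  show "x \<in> unit_cube_at (\<chi> i. \<lfloor>x $ i\<rfloor>)"
    by (auto simp: mem_unit_cube_at)
qed

lemma finite_int_vec_box: "finite {k :: int ^ 'n. \<forall>i. a \<le> k $ i \<and> k $ i \<le> b}"
proof (rule finite_subset)
  show "{k :: int ^ 'n. \<forall>i. a \<le> k $ i \<and> k $ i \<le> b} \<subseteq> vec_lambda ` (PiE UNIV (\<lambda>_. {a..b}))"
  proof
    fix k :: "int ^ 'n" assume "k \<in> {k. \<forall>i. a \<le> k $ i \<and> k $ i \<le> b}"
    then have "vec_nth k \<in> PiE UNIV (\<lambda>_. {a..b})" by auto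
    then show "k \<in> vec_lambda ` (PiE UNIV (\<lambda>_. {a..b}))"
      by (intro image_eqI[of _ _ "vec_nth k"]) auto
  qed
qed (intro finite_imageI finite_PiE, auto)

lemma finite_unit_cubes_meeting:
  fixes A :: "(real ^ 'n) set"
  assumes "bounded A"
  shows "finite {k. unit_cube_at k \<inter> A \<noteq> {}}"
proof -
  obtain R where R: "\<And>x. x \<in> A \<Longrightarrow> norm x \<le> R"
    using assms by (auto simp: bounded_iff)
  have "{k. unit_cube_at k \<inter> A \<noteq> {}} \<subseteq> {k. \<forall>i. - \<lceil>R\<rceil> - 1 \<le> k $ i \<and> k $ i \<le> \<lceil>R\<rceil>}"
  proof safe
    fix k x i assume x: "x \<in> unit_cube_at k" "x \<in> A"
    have "\<bar>x $ i\<bar> \<le> R" using component_le_norm_cart[of x i] R[OF x(2)] by linarith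
    moreover have "real_of_int (k $ i) \<le> x $ i" "x $ i \<le> real_of_int (k $ i) + 1"
      using x(1) by (auto simp: mem_unit_cube_at)
    ultimately show "- \<lceil>R\<rceil> - 1 \<le> k $ i" "k $ i \<le> \<lceil>R\<rceil>" by linarith+
  qed
  then show ?thesis
    using finite_int_vec_box by (rule finite_subset)
qed

lemma ennpowr_indicator: "ennpowr (indicator A x) p = indicator A x"
  by (simp add: indicator_def)

abbreviation cube_measure :: "int ^ 'n \<Rightarrow> (real ^ 'n) measure" where
  "cube_measure k \<equiv> restrict_space lborel (unit_cube_at k)"

lemma borel_measurable_cube [measurable (raw)]:
  "u \<in> borel_measurable borel \<Longrightarrow> u \<in> borel_measurable (cube_measure k)"
  by (intro measurable_restrict_space1) simp

lemma nn_integral_cube: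
  "(\<integral>\<^sup>+x. u x \<partial>cube_measure k) = (\<integral>\<^sup>+x. u x * indicator (unit_cube_at k) x \<partial>lborel)"
  by (rule nn_integral_restrict_space) simp

lemma AE_cube: "(AE x in lborel. P x) \<Longrightarrow> (AE x in cube_measure k. P x)"
  by (subst AE_restrict_space_iff) (auto elim: eventually_mono)

lemma nn_integral_cube_shift:
  fixes h :: "real ^ 'n \<Rightarrow> ennreal"
  assumes [measurable]: "h \<in> borel_measurable borel"
  shows "(\<integral>\<^sup>+x. h (x - (\<chi> i. real_of_int (j $ i))) \<partial>cube_measure k) = (\<integral>\<^sup>+x. h x \<partial>cube_measure (k - j))"
proof -
  let ?b = "\<chi> i. real_of_int (j $ i)"
  have ind: "indicator (unit_cube_at k) x = (indicator (unit_cube_at (k - j)) (x - ?b) :: ennreal)" for x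
    by (auto simp: indicator_def mem_unit_cube_at algebra_simps)
  show ?thesis
    unfolding nn_integral_cube ind
    by (rule nn_integral_lborel_diff[where f="\<lambda>x. h x * indicator (unit_cube_at (k - j)) x"]) measurable
qed

section \<open>The amalgam quasi-norm and its local convolution estimate\<close>

definition amalgam :: "real \<Rightarrow> real \<Rightarrow> (real ^ 'n \<Rightarrow> ennreal) \<Rightarrow> ennreal" where
  "amalgam p q u = nrm q (count_space UNIV) (\<lambda>k. nrm p (cube_measure k) u)"

definition rho :: "real \<Rightarrow> real \<Rightarrow> (real ^ 'n \<Rightarrow> ennreal) \<Rightarrow> ennreal" where
  "rho p q u = ennpowr (amalgam p q u) (min 1 q)"

text \<open>Subtracting a point of the unit cube from a point of cube \<open>k\<close> leads into
  one of the cubes \<open>k - i\<close> with \<open>i\<close> in this set. Its cardinality will be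
  the constant \<open>K\<close>.\<close>

definition neighbours :: "(int ^ 'n) set" where
  "neighbours = {i. \<forall>j. 0 \<le> i $ j \<and> i $ j \<le> 1}"

lemma finite_neighbours: "finite neighbours"
  unfolding neighbours_def by (rule finite_int_vec_box)

lemma card_neighbours: "1 \<le> card (neighbours :: (int ^ 'n) set)"
proof -
  have "(0 :: int ^ 'n) \<in> neighbours" by (simp add: neighbours_def)
  then show ?thesis
    using finite_neighbours by (metis One_nat_def Suc_leI card_gt_0_iff empty_iff)
qed

lemma nrm_cube_less_top:
  assumes "0 < q" "amalgam p q v < top"
  shows "nrm p (cube_measure k) v < top"
proof -
  have "ennpowr (nrm p (cube_measure k) v) q \<le> (\<integral>\<^sup>+k. ennpowr (nrm p (cube_measure k) v) q \<partial>count_space UNIV)"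
    by (rule nn_integral_ge_point) simp
  also have "\<dots> < top"
    using assms(2) by (simp add: amalgam_def nrm_def[of q])
  finally show ?thesis by simp
qed

lemma ennpowr_nrm_sum_le:
  assumes q: "0 < q" and "finite I" and [measurable]: "\<And>i. i \<in> I \<Longrightarrow> u i \<in> borel_measurable M"
  shows "ennpowr (nrm q M (\<lambda>x. \<Sum>i\<in>I. u i x)) (min 1 q) \<le> (\<Sum>i\<in>I. ennpowr (nrm q M (u i)) (min 1 q))"
proof -
  obtain \<beta> where \<beta>: "bij_betw \<beta> {..<card I} I"
    using ex_bij_betw_nat_finite[OF assms(2)] by (auto simp: atLeast0LessThan)
  define v where "v n x = (if n < card I then u (\<beta> n) x else 0)" for n x
  have \<beta>I: "n < card I \<Longrightarrow> \<beta> n \<in> I" for n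
    using \<beta> by (auto dest: bij_betwE)
  have [measurable]: "v n \<in> borel_measurable M" for n
    using assms(3)[OF \<beta>I] by (cases "n < card I") (auto simp: v_def[abs_def])
  have "(\<Sum>n. v n x) = (\<Sum>i\<in>I. u i x)" for x
  proof -
    have "(\<Sum>n. v n x) = (\<Sum>n<card I. v n x)"
      by (rule suminf_finite) (auto simp: v_def)
    also have "\<dots> = (\<Sum>n<card I. u (\<beta> n) x)" by (simp add: v_def)
    also have "\<dots> = (\<Sum>i\<in>I. u i x)" by (rule sum.reindex_bij_betw[OF \<beta>])
    finally show ?thesis .
  qed
  moreover have "(\<Sum>n. ennpowr (nrm q M (v n)) (min 1 q)) = (\<Sum>i\<in>I. ennpowr (nrm q M (u i)) (min 1 q))"
  proof -
    have "(\<Sum>n. ennpowr (nrm q M (v n)) (min 1 q)) = (\<Sum>n<card I. ennpowr (nrm q M (v n)) (min 1 q))"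
      by (rule suminf_finite) (auto simp: v_def[abs_def] nrm_def)
    also have "\<dots> = (\<Sum>n<card I. ennpowr (nrm q M (u (\<beta> n))) (min 1 q))"
      by (intro sum.cong) (auto simp: v_def[abs_def])
    also have "\<dots> = (\<Sum>i\<in>I. ennpowr (nrm q M (u i)) (min 1 q))"
      by (rule sum.reindex_bij_betw[OF \<beta>])
    finally show ?thesis .
  qed
  ultimately show ?thesis
    using ennpowr_nrm_suminf_le[OF q, of v M] by simp
qed

text \<open>Young's inequality on one cube. With \<open>u\<close> normalized to a probability
  density \<open>w\<close>, Jensen's inequality moves the \<open>p\<close>-th power under the
  convolution onto \<open>v\<close>; seen from cube \<open>k\<close>, only the values of
  \<open>v\<close> on the neighbouring cubes enter.\<close>

lemma nrm_cube_nconv_le: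
  fixes u v :: "real ^ 'n \<Rightarrow> ennreal"
  assumes p: "1 \<le> p" and [measurable]: "u \<in> borel_measurable borel" "v \<in> borel_measurable borel"
    and u0: "\<And>x. x \<notin> cbox 0 One \<Longrightarrow> u x = 0" and fin: "(\<integral>\<^sup>+x. u x \<partial>lborel) < top"
  shows "nrm p (cube_measure k) (nconv u v) \<le> (\<integral>\<^sup>+x. u x \<partial>lborel) * (\<Sum>i\<in>neighbours. nrm p (cube_measure (k - i)) v)"
proof (cases "(\<integral>\<^sup>+x. u x \<partial>lborel) = 0")
  case True
  then have "AE x in lborel. u x = 0"
    by (simp add: nn_integral_0_iff_AE)
  then have "nconv v u x = 0" for x
    unfolding nconv_def by (subst nn_integral_0_iff_AE) (auto elim: eventually_mono)
  then have "nconv u v = (\<lambda>x. 0)"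
    by (auto simp: nconv_commute[of u v])
  then show ?thesis by (simp add: nrm_def)
next
  case False
  define c where "c = (\<integral>\<^sup>+x. u x \<partial>lborel)"
  have c: "c \<noteq> 0" "c < top" using False fin by (auto simp: c_def)
  define w where "w x = u x / c" for x
  have [measurable]: "w \<in> borel_measurable borel"
    unfolding w_def[abs_def] by measurable
  have w1: "(\<integral>\<^sup>+x. w x \<partial>lborel) = 1"
    unfolding w_def using c by (simp add: nn_integral_divide flip: c_def add: ennreal_divide_self)
  have "u x = c * w x" for x
    unfolding w_def using c by (simp add: ennreal_times_divide mult.commute[of c] ennreal_mult_divide_eq)
  then have uw: "nconv u v = (\<lambda>x. c * nconv w v x)"
    by (simp add: nconv_def fun_eq_iff mult.assoc nn_integral_cmult)
  \<comment> \<open>The \<open>p\<close>-th power of \<open>v\<close> on the neighbouring cubes.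
    Points on common faces are counted several times, which is harmless for an upper bound.\<close>
  define V where "V y = ennpowr (v y) p * (\<Sum>i\<in>neighbours. indicator (unit_cube_at (k - i)) y)" for y
  have [measurable]: "V \<in> borel_measurable borel"
    unfolding V_def[abs_def] by measurable
  have Jensen: "ennpowr (nconv w v x) p \<le> (\<integral>\<^sup>+y. w (x - y) * ennpowr (v y) p \<partial>lborel)" for x
    unfolding nconv_def using w1 p by (intro ennpowr_Jensen) (auto simp: nn_integral_lborel_minus)
  have supp: "w (x - y) * ennpowr (v y) p \<le> w (x - y) * V y" if x: "x \<in> unit_cube_at k" for x y
  proof (cases "x - y \<in> cbox 0 One")
    case True
    \<comment> \<open>A coordinate of \<open>y\<close> not below the lower face of cube
      \<open>k\<close> needs no shift; otherwise it lies within distance 1 below \<open>x\<close>,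
      hence in the layer before.\<close>
    define i where "i = (\<chi> j. if real_of_int (k $ j) \<le> y $ j then 0 else (1 :: int))"
    have "i \<in> neighbours" by (simp add: neighbours_def i_def)
    moreover have "y \<in> unit_cube_at (k - i)"
      unfolding mem_unit_cube_at
    proof
      fix j
      have "real_of_int (k $ j) \<le> x $ j" "x $ j \<le> real_of_int (k $ j) + 1"
        "y $ j \<le> x $ j" "x $ j \<le> y $ j + 1"
        using x True by (auto simp: mem_unit_cube_at One_vec_eq mem_box_cart algebra_simps)
      then show "real_of_int ((k - i) $ j) \<le> y $ j \<and> y $ j \<le> real_of_int ((k - i) $ j) + 1"
        by (auto simp: i_def)
    qed
    ultimately have "(1::ennreal) \<le> (\<Sum>i\<in>neighbours. indicator (unit_cube_at (k - i)) y)"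
      using member_le_sum[of i neighbours "\<lambda>i. indicator (unit_cube_at (k - i)) y :: ennreal"] finite_neighbours
      by auto
    then have "ennpowr (v y) p * 1 \<le> V y"
      unfolding V_def by (intro mult_left_mono) auto
    then show ?thesis by (intro mult_left_mono) auto
  qed (simp add: w_def u0)
  \<comment> \<open>Once \<open>V\<close> has localized \<open>v\<close>, the domain can be enlarged
    to the whole space, where the integral of the convolution is a product and \<open>w\<close> has
    integral 1.\<close>
  have "(\<integral>\<^sup>+x. ennpowr (nconv w v x) p \<partial>cube_measure k) \<le> (\<integral>\<^sup>+x. nconv w V x \<partial>lborel)"
    unfolding nn_integral_cube
  proof (intro nn_integral_mono)
    fix x
    show "ennpowr (nconv w v x) p * indicator (unit_cube_at k) x \<le> nconv w V x"
    proof (cases "x \<in> unit_cube_at k")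
      case True
      have "(\<integral>\<^sup>+y. w (x - y) * ennpowr (v y) p \<partial>lborel) \<le> nconv w V x"
        unfolding nconv_def by (intro nn_integral_mono supp True)
      with Jensen[of x] True show ?thesis by simp
    qed simp
  qed
  also have "\<dots> = (\<integral>\<^sup>+x. V x \<partial>lborel)"
    by (simp add: nn_integral_nconv w1)
  also have "\<dots> = (\<Sum>i\<in>neighbours. (\<integral>\<^sup>+x. ennpowr (v x) p \<partial>cube_measure (k - i)))"
    unfolding V_def nn_integral_cube sum_distrib_left by (rule nn_integral_sum) measurable
  finally have "nrm p (cube_measure k) (nconv w v) \<le> ennpowr (\<Sum>i\<in>neighbours. (\<integral>\<^sup>+x. ennpowr (v x) p \<partial>cube_measure (k - i))) (1 / p)"
    unfolding nrm_def using p by (intro ennpowr_mono) auto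
  also have "\<dots> \<le> (\<Sum>i\<in>neighbours. nrm p (cube_measure (k - i)) v)"
    unfolding nrm_def using p by (intro ennpowr_sum_le finite_neighbours) auto
  finally have "c * nrm p (cube_measure k) (nconv w v) \<le> c * (\<Sum>i\<in>neighbours. nrm p (cube_measure (k - i)) v)"
    by (rule mult_left_mono) simp
  moreover have "nrm p (cube_measure k) (nconv u v) = c * nrm p (cube_measure k) (nconv w v)"
    unfolding uw using p by (intro nrm_cmult) auto
  ultimately show ?thesis by (simp add: c_def)
qed

lemma nrm_count_space_shift:
  fixes a :: "int ^ 'n \<Rightarrow> ennreal"
  shows "nrm q (count_space UNIV) (\<lambda>k. a (k - i)) = nrm q (count_space UNIV) a"
proof -
  have "bij (\<lambda>k. k - i)" by (rule bijI') (auto intro: exI[of _ "_ + i"])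
  then show ?thesis
    unfolding nrm_def by (subst nn_integral_bij_count_space[symmetric, of "\<lambda>k. k - i" UNIV UNIV]) auto
qed

text \<open>Most assumptions are verified on each cube and again for the sequence of local norms. In
  the convolution estimate every neighbour contributes a translate of that sequence, and translation
  preserves its quasi-norm; hence the cardinality as constant.\<close>

lemma conv_module_rho:
  assumes p: "1 \<le> p" and q: "0 < q"
  shows "conv_module (rho p q :: (real ^ 'n \<Rightarrow> ennreal) \<Rightarrow> ennreal) (min 1 q) (real (card (neighbours :: (int ^ 'n) set)))"
proof
  show "0 < min 1 q" using q by simp
  show "1 \<le> real (card (neighbours :: (int ^ 'n) set))"
    using card_neighbours[where 'n='n] by linarith
next
  fix u v :: "real ^ 'n \<Rightarrow> ennreal"
  assume "AE x in lborel. u x \<le> v x"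
  then have "nrm p (cube_measure k) u \<le> nrm p (cube_measure k) v" for k
    using p by (intro nrm_mono_AE AE_cube) auto
  then show "rho p q u \<le> rho p q v"
    unfolding rho_def amalgam_def using q
    by (intro ennpowr_mono nrm_mono_AE[OF q] AE_I2) auto
next
  fix w :: "nat \<Rightarrow> real ^ 'n \<Rightarrow> ennreal"
  assume [measurable]: "\<And>n. w n \<in> borel_measurable borel"
  have "rho p q (\<lambda>x. \<Sum>n. w n x) \<le> ennpowr (nrm q (count_space UNIV) (\<lambda>k. \<Sum>n. nrm p (cube_measure k) (w n))) (min 1 q)"
    unfolding rho_def amalgam_def using p q
    by (intro ennpowr_mono nrm_mono_AE AE_I2 nrm_suminf_le) auto
  also have "\<dots> \<le> (\<Sum>n. rho p q (w n))"
    unfolding rho_def amalgam_def by (rule ennpowr_nrm_suminf_le[OF q]) simp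
  finally show "rho p q (\<lambda>x. \<Sum>n. w n x) \<le> (\<Sum>n. rho p q (w n))" .
next
  fix u :: "real ^ 'n \<Rightarrow> ennreal" and c
  assume [measurable]: "u \<in> borel_measurable borel"
  show "rho p q (\<lambda>x. c * u x) = ennpowr c (min 1 q) * rho p q u"
    unfolding rho_def amalgam_def using p q by (simp add: nrm_cmult ennpowr_mult)
next
  fix u :: "real ^ 'n \<Rightarrow> ennreal"
  assume [measurable]: "u \<in> borel_measurable borel" and "rho p q u = 0"
  then have "nrm q (count_space UNIV) (\<lambda>k. nrm p (cube_measure k) u) = 0"
    by (simp add: rho_def amalgam_def)
  from nrm_eq_0[OF q _ this] have "nrm p (cube_measure k) u = 0" for k
    by (simp add: AE_count_space)
  then have "AE x in cube_measure k. u x = 0" for k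
    using p by (intro nrm_eq_0[of p]) auto
  then have "AE x in lborel. x \<in> unit_cube_at k \<longrightarrow> u x = 0" for k
    by (subst (asm) AE_restrict_space_iff) auto
  \<comment> \<open>There are countably many cubes, so one null set serves for all of them.\<close>
  then have "AE x in lborel. \<forall>k. x \<in> unit_cube_at k \<longrightarrow> u x = 0"
    unfolding AE_all_countable ..
  then show "AE x in lborel. u x = 0"
    by eventually_elim (use ex_unit_cube_at in blast)
next
  fix w :: "nat \<Rightarrow> real ^ 'n \<Rightarrow> ennreal" and v
  assume [measurable]: "\<And>n. w n \<in> borel_measurable borel" "v \<in> borel_measurable borel"
    and lim: "AE x in lborel. (\<lambda>n. w n x) \<longlonglongrightarrow> 0" and le: "\<And>n. AE x in lborel. w n x \<le> v x"
    and "rho p q v < top"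
  then have fin: "amalgam p q v < top" by (simp add: rho_def)
  \<comment> \<open>Dominated convergence is used inside each cube and once more over the lattice,
    where the local norms of \<open>v\<close> are the majorant.\<close>
  have "(\<lambda>n. nrm p (cube_measure k) (w n)) \<longlonglongrightarrow> 0" for k
    using p nrm_cube_less_top[OF q fin, of k] by (intro tendsto_nrm_0[where v=v] AE_cube lim le) auto
  moreover have "nrm p (cube_measure k) (w n) \<le> nrm p (cube_measure k) v" for n k
    using p by (intro nrm_mono_AE AE_cube le) auto
  ultimately have "(\<lambda>n. amalgam p q (w n)) \<longlonglongrightarrow> 0"
    unfolding amalgam_def using fin
    by (intro tendsto_nrm_0[OF q, where v="\<lambda>k. nrm p (cube_measure k) v"] AE_I2) (auto simp: amalgam_def)
  then show "(\<lambda>n. rho p q (w n)) \<longlonglongrightarrow> 0"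
    using tendsto_ennpowr[of "min 1 q" "\<lambda>n. amalgam p q (w n)" 0] q by (simp add: rho_def)
next
  fix A :: "(real ^ 'n) set"
  assume A: "A \<in> sets borel" "bounded A"
  let ?K = "{k. unit_cube_at k \<inter> A \<noteq> {}}"
  have zero: "nrm p (cube_measure k) (indicator A) = 0" if "k \<notin> ?K" for k
  proof -
    have eq: "indicator A x * indicator (unit_cube_at k) x = (0 :: ennreal)" for x
      using that by (auto simp: indicator_def)
    show ?thesis
      unfolding nrm_def nn_integral_cube ennpowr_indicator eq by simp
  qed
  have fin: "nrm p (cube_measure k) (indicator A) < top" for k
  proof -
    have "(\<integral>\<^sup>+x. indicator A x * indicator (unit_cube_at k) x \<partial>lborel) \<le> (\<integral>\<^sup>+x. indicator A x \<partial>lborel)"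
      by (intro nn_integral_mono) (auto simp: indicator_def)
    also have "\<dots> < top" using emeasure_bounded_finite[OF A(2)] A(1) by simp
    finally show ?thesis by (simp add: nrm_def nn_integral_cube ennpowr_indicator)
  qed
  have "(\<integral>\<^sup>+k. ennpowr (nrm p (cube_measure k) (indicator A)) q \<partial>count_space UNIV)
      = (\<Sum>k\<in>?K. ennpowr (nrm p (cube_measure k) (indicator A)) q)"
    using zero by (intro nn_integral_count_space' finite_unit_cubes_meeting A) auto
  also have "\<dots> < top" using fin finite_unit_cubes_meeting[OF A(2)] by simp
  finally show "rho p q (indicator A) < top"
    by (simp add: rho_def amalgam_def nrm_def[of q])
next
  fix u v :: "real ^ 'n \<Rightarrow> ennreal"
  assume [measurable]: "u \<in> borel_measurable borel" "v \<in> borel_measurable borel"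
    and u0: "\<And>x. x \<notin> cbox 0 One \<Longrightarrow> u x = 0" and fin: "(\<integral>\<^sup>+x. u x \<partial>lborel) < top"
  define c where "c = (\<integral>\<^sup>+x. u x \<partial>lborel)"
  have "amalgam p q (nconv u v) \<le> nrm q (count_space UNIV) (\<lambda>k. c * (\<Sum>i\<in>neighbours. nrm p (cube_measure (k - i)) v))"
    unfolding amalgam_def c_def using q p fin u0
    by (intro nrm_mono_AE AE_I2 nrm_cube_nconv_le) auto
  also have "\<dots> = c * nrm q (count_space UNIV) (\<lambda>k. (\<Sum>i\<in>neighbours. nrm p (cube_measure (k - i)) v))"
    using q by (intro nrm_cmult) auto
  finally have "rho p q (nconv u v) \<le> ennpowr c (min 1 q) *
      ennpowr (nrm q (count_space UNIV) (\<lambda>k. (\<Sum>i\<in>neighbours. nrm p (cube_measure (k - i)) v))) (min 1 q)"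
    unfolding rho_def ennpowr_mult[symmetric] using q by (intro ennpowr_mono) auto
  also have "\<dots> \<le> ennpowr c (min 1 q) * (\<Sum>i\<in>(neighbours :: (int ^ 'n) set).
      ennpowr (nrm q (count_space UNIV) (\<lambda>k. nrm p (cube_measure (k - i)) v)) (min 1 q))"
    by (intro mult_left_mono ennpowr_nrm_sum_le[OF q finite_neighbours]) auto
  also have "\<dots> = ennreal (real (card (neighbours :: (int ^ 'n) set))) * ennpowr c (min 1 q) * rho p q v"
    by (simp add: nrm_count_space_shift[where a="\<lambda>k. nrm p (cube_measure k) v"] rho_def amalgam_def
        ennreal_of_nat_eq_real_of_nat mult_ac)
  finally show "rho p q (nconv u v) \<le> ennreal (real (card (neighbours :: (int ^ 'n) set))) * ennpowr (\<integral>\<^sup>+x. u x \<partial>lborel) (min 1 q) * rho p q v"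
    by (simp add: c_def)
qed

lemma rho_shift:
  fixes u :: "real ^ 'n \<Rightarrow> ennreal"
  assumes [measurable]: "u \<in> borel_measurable borel"
  shows "rho p q (\<lambda>x. u (x - (\<chi> i. real_of_int (j $ i)))) = rho p q u"
proof -
  have "nrm p (cube_measure k) (\<lambda>x. u (x - (\<chi> i. real_of_int (j $ i)))) = nrm p (cube_measure (k - j)) u" for k
    unfolding nrm_def by (subst nn_integral_cube_shift[where h="\<lambda>x. ennpowr (u x) p"]) auto
  then show ?thesis
    by (simp add: rho_def amalgam_def nrm_count_space_shift[where a="\<lambda>k. nrm p (cube_measure k) u"])
qed

lemma rho_convolution_less_top:
  fixes u v :: "real ^ 'n \<Rightarrow> ennreal"
  assumes p: "1 \<le> p" and r: "0 < r" "r \<le> 1" "r \<le> q"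
    and [measurable]: "u \<in> borel_measurable borel" "v \<in> borel_measurable borel"
    and u: "amalgam 1 r u < top" and v: "amalgam p q v < top"
  shows "rho p q (nconv u v) < top"
proof -
  have q: "0 < q" using r by simp
  interpret R: conv_module "rho p q :: (real ^ 'n \<Rightarrow> ennreal) \<Rightarrow> ennreal" "min 1 q" "real (card (neighbours :: (int ^ 'n) set))"
    using p q by (rule conv_module_rho)
  let ?K = "real (card (neighbours :: (int ^ 'n) set))"
  let ?b = "\<lambda>j :: int ^ 'n. \<chi> i. real_of_int (j $ i)"
  define A where "A j = (\<integral>\<^sup>+x. u x \<partial>cube_measure j)" for j
  have A_eq: "A j = nrm 1 (cube_measure j) u" for j
    by (simp add: A_def nrm_def)
  have A_fin: "A j < top" for j
    unfolding A_eq by (rule nrm_cube_less_top[OF r(1) u])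
  define U where "U j x = u x * indicator (unit_cube_at j) x" for j x
  have [measurable]: "U j \<in> borel_measurable borel" for j
    unfolding U_def[abs_def] by measurable
  have piece: "rho p q (nconv (U j) v) \<le> ennreal ?K * ennpowr (A j) (min 1 q) * rho p q v" for j
  proof -
    \<comment> \<open>The piece moved to the unit cube. Its convolution with \<open>v\<close> is an
      integer translate of that of \<open>U j\<close>, so it has the same
      \<open>rho\<close>.\<close>
    define w where "w x = U j (x - (- ?b j))" for x
    have [measurable]: "w \<in> borel_measurable borel"
      unfolding w_def[abs_def] by measurable
    have "nconv (U j) v = (\<lambda>x. nconv w v (x - ?b j))"
      by (simp add: nconv_def w_def fun_eq_iff algebra_simps)
    then have "rho p q (nconv (U j) v) = rho p q (nconv w v)"
      using rho_shift[of "nconv w v"] by simp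
    also have "\<dots> \<le> ennreal ?K * ennpowr (\<integral>\<^sup>+x. w x \<partial>lborel) (min 1 q) * rho p q v"
    proof (rule R.nconv_le)
      have int: "(\<integral>\<^sup>+x. w x \<partial>lborel) = A j"
        unfolding w_def A_def nn_integral_cube U_def[symmetric] by (rule nn_integral_lborel_diff) simp
      then show "(\<integral>\<^sup>+x. w x \<partial>lborel) < top" using A_fin by simp
      fix x :: "real ^ 'n" assume "x \<notin> cbox 0 One"
      then have "x + ?b j \<notin> unit_cube_at j"
        by (auto simp: One_vec_eq mem_box_cart mem_unit_cube_at not_le algebra_simps)
      then show "w x = 0" by (simp add: w_def U_def)
    qed auto
    also have "(\<integral>\<^sup>+x. w x \<partial>lborel) = A j"
      unfolding w_def A_def nn_integral_cube U_def[symmetric] by (rule nn_integral_lborel_diff) simp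
    finally show ?thesis .
  qed
  \<comment> \<open>Countable subadditivity is stated for sequences, so the cubes have to be
    enumerated.\<close>
  obtain \<beta> :: "nat \<Rightarrow> int ^ 'n" where \<beta>: "bij \<beta>"
  proof -
    have "inj (\<lambda>n. (\<chi> i. int n) :: int ^ 'n)" by (auto simp: inj_def vec_eq_iff)
    then have "infinite (UNIV :: (int ^ 'n) set)"
      using infinite_iff_countable_subset by blast
    then show thesis
      using countableE_infinite[of "UNIV :: (int ^ 'n) set"] bij_betw_inv that by (metis countableI_type)
  qed
  have sum_count: "(\<Sum>n. f (\<beta> n)) = (\<integral>\<^sup>+j. f j \<partial>count_space UNIV)" for f :: "int ^ 'n \<Rightarrow> ennreal"
    using nn_integral_bij_count_space[of \<beta> UNIV UNIV f] \<beta> by (simp add: nn_integral_count_space_nat)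
  \<comment> \<open>The exponent \<open>r / min 1 q\<close> is at most 1 by \<open>r \<le> 1\<close>
    and \<open>r \<le> q\<close>, so the power is subadditive. This is the inclusion of sequence
    spaces with exponents \<open>r\<close> and \<open>min 1 q\<close>.\<close>
  have "ennpowr (\<Sum>n. ennpowr (A (\<beta> n)) (min 1 q)) (r / min 1 q) \<le> (\<Sum>n. ennpowr (ennpowr (A (\<beta> n)) (min 1 q)) (r / min 1 q))"
    using r by (intro ennpowr_suminf_le) auto
  also have "\<dots> = (\<Sum>n. ennpowr (A (\<beta> n)) r)"
    using q by simp
  also have "\<dots> = (\<integral>\<^sup>+j. ennpowr (nrm 1 (cube_measure j) u) r \<partial>count_space UNIV)"
    by (subst sum_count) (simp add: A_eq)
  also have "\<dots> < top"
    using u by (simp add: amalgam_def nrm_def[of r])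
  finally have sum_fin: "(\<Sum>n. ennpowr (A (\<beta> n)) (min 1 q)) < top" by simp
  \<comment> \<open>Only an inequality, because closed cubes share faces.\<close>
  have "u x \<le> (\<Sum>n. U (\<beta> n) x)" for x
  proof -
    obtain k where "x \<in> unit_cube_at k" using ex_unit_cube_at by blast
    moreover obtain n where "\<beta> n = k" using \<beta> by (metis bij_pointE)
    ultimately have "u x = U (\<beta> n) x" by (simp add: U_def)
    also have "\<dots> \<le> (\<Sum>n. U (\<beta> n) x)"
      using sum_le_suminf[of "\<lambda>n. U (\<beta> n) x" "{n}"] by simp
    finally show ?thesis .
  qed
  then have "rho p q (nconv u v) \<le> rho p q (nconv (\<lambda>x. \<Sum>n. U (\<beta> n) x) v)"
    by (intro R.mono AE_I2 nconv_mono) auto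
  also have "nconv (\<lambda>x. \<Sum>n. U (\<beta> n) x) v = (\<lambda>x. \<Sum>n. nconv (U (\<beta> n)) v x)"
    by (intro ext nconv_suminf_left) auto
  also have "rho p q \<dots> \<le> (\<Sum>n. rho p q (nconv (U (\<beta> n)) v))"
    by (rule R.suminf) measurable
  also have "\<dots> \<le> (\<Sum>n. ennreal ?K * ennpowr (A (\<beta> n)) (min 1 q) * rho p q v)"
    by (intro suminf_le piece) auto
  also have "\<dots> = ennreal ?K * (\<Sum>n. ennpowr (A (\<beta> n)) (min 1 q)) * rho p q v"
    by simp
  also have "\<dots> < top"
    using sum_fin v by (simp add: ennreal_mult_less_top rho_def)
  finally show ?thesis .
qed

section \<open>Lebesgue measurable representatives\<close>

lemma lebesgue_ex_borel:
  fixes f :: "real ^ 'n \<Rightarrow> complex"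
  assumes f [measurable]: "f \<in> borel_measurable lebesgue"
  obtains f' where "f' \<in> borel_measurable borel" "AE x in lborel. f x = f' x"
proof -
  have "(\<lambda>x. Re (f x)) \<in> borel_measurable lebesgue" "(\<lambda>x. Im (f x)) \<in> borel_measurable lebesgue"
    by measurable
  from completion_ex_borel_measurable_real[OF this(1)] completion_ex_borel_measurable_real[OF this(2)]
  obtain R I where [measurable]: "R \<in> borel_measurable borel" "I \<in> borel_measurable borel"
    and AE: "AE x in lborel. Re (f x) = R x" "AE x in lborel. Im (f x) = I x"
    by auto
  show thesis
  proof
    show "(\<lambda>x. Complex (R x) (I x)) \<in> borel_measurable borel"
      unfolding Complex_eq by measurable
    from AE show "AE x in lborel. f x = Complex (R x) (I x)"
      by eventually_elim (simp add: complex_eq_iff)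
  qed
qed

text \<open>Neither completing the measure nor changing the function on a null set affects the
  integrals over the cubes.\<close>

lemma WL_norm_eq_amalgam:
  fixes f f' :: "real ^ 'n \<Rightarrow> complex"
  assumes p: "0 < p" and q: "0 < q" and [measurable]: "f' \<in> borel_measurable borel"
    and eq: "AE x in lborel. f x = f' x"
  shows "WL_norm (ennreal p) (ennreal q) f = amalgam p q (enorm f')"
proof -
  have "local_norms (ennreal p) f k = nrm p (cube_measure k) (enorm f')" for k
  proof -
    have "(\<integral>\<^sup>+x. ennpowr (enorm f x) p \<partial>lebesgue_on (unit_cube_at k))
        = (\<integral>\<^sup>+x. ennpowr (enorm f x) p * indicator (unit_cube_at k) x \<partial>lebesgue)"
      by (rule nn_integral_restrict_space) simp
    also have "\<dots> = (\<integral>\<^sup>+x. ennpowr (enorm f' x) p * indicator (unit_cube_at k) x \<partial>lebesgue)"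
      using AE_completion[OF eq] by (intro nn_integral_cong_AE) (auto elim: eventually_mono)
    also have "\<dots> = (\<integral>\<^sup>+x. ennpowr (enorm f' x) p \<partial>cube_measure k)"
      by (simp only: nn_integral_completion nn_integral_cube)
    finally show ?thesis
      using p by (simp add: local_norms_def Lp_norm_def nrm_def)
  qed
  then show ?thesis
    using q by (simp add: WL_norm_def Lp_norm_def amalgam_def nrm_def[of q])
qed

text \<open>The norm sees a function only up to null sets, so one representative of finite norm
  makes all of them so. This describes the functions over which \<open>conv_set\<close>
  ranges.\<close>

lemma Union_WL:
  fixes f :: "real ^ 'n \<Rightarrow> complex"
  assumes "0 < p" "0 < q"
  shows "f \<in> \<Union>(WL (ennreal p) (ennreal q)) \<longleftrightarrow>
    f \<in> borel_measurable lebesgue \<and> WL_norm (ennreal p) (ennreal q) f < \<infinity>"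
proof
  assume "f \<in> \<Union>(WL (ennreal p) (ennreal q))"
  then obtain g where g: "WL_norm (ennreal p) (ennreal q) g < \<infinity>" and gf: "(g, f) \<in> ae_eq"
    by (auto simp: WL_def quotient_def)
  then have f: "f \<in> borel_measurable lebesgue" and "AE x in lborel. g x = f x"
    by (auto simp: ae_eq_def AE_completion_iff)
  moreover obtain f' where f': "f' \<in> borel_measurable borel" "AE x in lborel. f x = f' x"
    using lebesgue_ex_borel[OF f] .
  ultimately have "AE x in lborel. g x = f' x"
    by (auto elim: eventually_elim2)
  then show "f \<in> borel_measurable lebesgue \<and> WL_norm (ennreal p) (ennreal q) f < \<infinity>"
    using f g WL_norm_eq_amalgam[OF assms f'] WL_norm_eq_amalgam[OF assms f'(1), of g] by simp
next
  assume f: "f \<in> borel_measurable lebesgue \<and> WL_norm (ennreal p) (ennreal q) f < \<infinity>"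
  then have "ae_eq `` {f} \<in> WL (ennreal p) (ennreal q)"
    unfolding WL_def by (intro quotientI) auto
  moreover have "f \<in> ae_eq `` {f}"
    using f by (auto simp: ae_eq_def)
  ultimately show "f \<in> \<Union>(WL (ennreal p) (ennreal q))" by blast
qed

text \<open>The equality holds at every \<open>x\<close>: the reflection of \<open>y\<close> to
  \<open>x - y\<close> preserves null sets, so for each fixed \<open>x\<close> the two integrands
  agree for almost every \<open>y\<close>.\<close>

lemma conv_eq_cconv:
  fixes f g f' g' :: "real ^ 'n \<Rightarrow> complex"
  assumes [measurable]: "f' \<in> borel_measurable borel" "g' \<in> borel_measurable borel"
    and f: "AE x in lborel. f x = f' x" and g: "AE x in lborel. g x = g' x"
  shows "conv f g = cconv f' g'"
    and "integrable lebesgue (\<lambda>y. f (x - y) * g y) \<longleftrightarrow> integrable lborel (\<lambda>y. f' (x - y) * g' y)"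
proof -
  have *: "(\<lambda>y. f (x - y) * g y) \<in> borel_measurable lebesgue \<and>
      (AE y in lebesgue. f (x - y) * g y = f' (x - y) * g' y)" for x
  proof -
    have m: "(\<lambda>y. f' (x - y) * g' y) \<in> borel_measurable lebesgue"
      by (intro measurable_completion) simp
    have "AE y in lborel. f' (x - y) * g' y = f (x - y) * g y"
      using AE_lborel_minus[OF f, of x] g by eventually_elim simp
    then have ae: "AE y in lebesgue. f' (x - y) * g' y = f (x - y) * g y"
      by (rule AE_completion)
    from borel_measurable_AE[OF m ae] ae show ?thesis
      by (auto elim: eventually_mono)
  qed
  have m: "(\<lambda>y. f' (x - y) * g' y) \<in> borel_measurable lebesgue" for x
    by (intro measurable_completion) simp
  show "conv f g = cconv f' g'"
  proof
    fix x
    have "conv f g x = (\<integral>y. f' (x - y) * g' y \<partial>lebesgue)"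
      unfolding conv_def using *[of x] m[of x] by (intro integral_cong_AE) auto
    then show "conv f g x = cconv f' g' x"
      by (simp add: cconv_def integral_completion)
  qed
  have "integrable lebesgue (\<lambda>y. f (x - y) * g y) \<longleftrightarrow> integrable lebesgue (\<lambda>y. f' (x - y) * g' y)"
    using *[of x] m[of x] by (intro integrable_cong_AE) auto
  then show "integrable lebesgue (\<lambda>y. f (x - y) * g y) \<longleftrightarrow> integrable lborel (\<lambda>y. f' (x - y) * g' y)"
    by (simp add: integrable_completion)
qed

text \<open>The support meets finitely many cubes, and a finite sum is finite for every exponent.
  This puts the first factor into the amalgam space for arbitrarily small \<open>r\<close>.\<close>

lemma amalgam_kernel_less_top:
  fixes f :: "real ^ 'n \<Rightarrow> complex"
  assumes f: "kernel f" and r: "0 < r"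
  shows "amalgam 1 r (enorm f) < top"
proof -
  let ?K = "{k. unit_cube_at k \<inter> cbox 0 (One :: real ^ 'n) \<noteq> {}}"
  have fin: "finite ?K" by (intro finite_unit_cubes_meeting bounded_cbox)
  have "nrm 1 (cube_measure k) (enorm f) = 0" if "k \<notin> ?K" for k
  proof -
    have eq: "ennpowr (enorm f x) 1 * indicator (unit_cube_at k) x = (0 :: ennreal)" for x
      using that kernelD(2)[OF f, of x] by (auto simp: indicator_def)
    show ?thesis
      unfolding nrm_def nn_integral_cube eq by simp
  qed
  then have "(\<integral>\<^sup>+k. ennpowr (nrm 1 (cube_measure k) (enorm f)) r \<partial>count_space UNIV)
      = (\<Sum>k\<in>?K. ennpowr (nrm 1 (cube_measure k) (enorm f)) r)"
    using fin by (intro nn_integral_count_space') auto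
  moreover have "nrm 1 (cube_measure k) (enorm f) < top" for k
  proof -
    have "(\<integral>\<^sup>+x. enorm f x * indicator (unit_cube_at k) x \<partial>lborel) \<le> (\<integral>\<^sup>+x. enorm f x \<partial>lborel)"
      by (intro nn_integral_mono) (auto simp: indicator_def)
    then show ?thesis
      using kernelD(3)[OF f] by (simp add: nrm_def nn_integral_cube)
  qed
  ultimately show ?thesis
    using fin by (simp add: amalgam_def nrm_def[of r])
qed

theorem theorem1p1:
  fixes r p q :: ennreal
  assumes "0 < r" "r \<le> 1"
    and "1 \<le> p" "p < \<infinity>"
    and "r \<le> q" "q < \<infinity>"
  shows "(\<forall>f \<in> \<Union>(WL 1 r :: (real ^ 'n \<Rightarrow> complex) set set). \<forall>g \<in> \<Union>(WL p q). conv_exists f g) \<and>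
         conv_set (WL 1 r) (WL p q) = (WL p q :: (real ^ 'n \<Rightarrow> complex) set set)"
proof -
  \<comment> \<open>All exponents are finite, so the \<open>esssup\<close> branch of
    \<open>Lp_norm\<close> never occurs and real exponents can be used.\<close>
  define P Q R where "P = enn2real p" "Q = enn2real q" "R = enn2real r"
  have "r < \<infinity>" using assms(2) by (rule le_less_trans) simp
  with assms have eq: "p = ennreal P" "q = ennreal Q" "r = ennreal R"
    by (auto simp: P_Q_R_def)
  have nonneg: "0 \<le> P" "0 \<le> Q" "0 \<le> R" by (auto simp: P_Q_R_def)
  have P: "1 \<le> P" and R: "0 < R" "R \<le> 1" "R \<le> Q"
    using assms nonneg unfolding eq by (auto simp flip: ennreal_1)
  have pos: "0 < P" "0 < Q" using P R by auto
  have WL1: "f \<in> \<Union>(WL 1 r) \<longleftrightarrow> f \<in> borel_measurable lebesgue \<and> WL_norm (ennreal 1) (ennreal R) f < \<infinity>"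
    for f :: "real ^ 'n \<Rightarrow> complex"
    using Union_WL[of 1 R f] R eq by simp
  note WL = Union_WL[OF pos, folded eq]
  interpret M: conv_module "rho P Q :: (real ^ 'n \<Rightarrow> ennreal) \<Rightarrow> ennreal" "min 1 Q" "real (card (neighbours :: (int ^ 'n) set))"
    using P pos(2) by (rule conv_module_rho)
  have *: "conv_exists f g \<and> conv f g \<in> borel_measurable lebesgue \<and> WL_norm p q (conv f g) < \<infinity>"
    if f: "f \<in> \<Union>(WL 1 r)" and g: "g \<in> \<Union>(WL p q)" for f g :: "real ^ 'n \<Rightarrow> complex"
  proof -
    obtain f' where [measurable]: "f' \<in> borel_measurable borel" and f': "AE x in lborel. f x = f' x"
      using f lebesgue_ex_borel[of f] unfolding WL1 by blast
    obtain g' where [measurable]: "g' \<in> borel_measurable borel" and g': "AE x in lborel. g x = g' x"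
      using g lebesgue_ex_borel[of g] unfolding WL by blast
    have "amalgam 1 R (enorm f') < top"
      using f R WL_norm_eq_amalgam[of 1 R f' f] f' unfolding WL1 by simp
    moreover have "amalgam P Q (enorm g') < top"
      using g pos WL_norm_eq_amalgam[of P Q g' g] g' unfolding WL by (simp add: eq)
    ultimately have fin: "rho P Q (nconv (enorm f') (enorm g')) < top"
      using P R by (intro rho_convolution_less_top) auto
    \<comment> \<open>Finiteness of one quantity yields both claims: finite values almost everywhere
      give the existence of the convolution, and monotonicity bounds its norm.\<close>
    have "AE x in lborel. nconv (enorm f') (enorm g') x < top"
      using fin by (intro M.AE_less_top) auto
    then have "AE x in lborel. integrable lebesgue (\<lambda>y. f (x - y) * g y)"
      unfolding conv_eq_cconv(2)[OF \<open>f' \<in> _\<close> \<open>g' \<in> _\<close> f' g']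
      by eventually_elim (intro integrable_cconv, auto)
    then have "conv_exists f g"
      unfolding conv_exists_def by (rule AE_completion)
    moreover have eq_conv: "conv f g = cconv f' g'"
      by (intro conv_eq_cconv f' g') auto
    moreover have "rho P Q (enorm (cconv f' g')) \<le> rho P Q (nconv (enorm f') (enorm g'))"
      by (intro M.mono AE_I2 enorm_cconv_le) auto
    then have "rho P Q (enorm (cconv f' g')) < top"
      using fin by (rule le_less_trans)
    then have "WL_norm p q (cconv f' g') < \<infinity>"
      using WL_norm_eq_amalgam[OF pos, of "cconv f' g'" "cconv f' g'"] by (simp add: eq rho_def)
    ultimately show ?thesis
      by (simp add: measurable_completion)
  qed
  have "ae_eq `` {conv f g} \<in> WL p q" if "f \<in> \<Union>(WL 1 r)" "g \<in> \<Union>(WL p q)" for f g :: "real ^ 'n \<Rightarrow> complex"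
    using *[OF that] unfolding WL_def by (intro quotientI) auto
  then have "conv_set (WL 1 r) (WL p q) \<subseteq> (WL p q :: (real ^ 'n \<Rightarrow> complex) set set)"
    by (auto simp: conv_set_def)
  \<comment> \<open>A Borel representative of the class is factored; its Borel factors serve
    directly as the representatives that \<open>conv_set\<close> asks for.\<close>
  moreover have "X \<in> conv_set (WL 1 r) (WL p q)" if X: "X \<in> WL p q" for X :: "(real ^ 'n \<Rightarrow> complex) set"
  proof -
    obtain h where h: "h \<in> borel_measurable lebesgue" "WL_norm p q h < \<infinity>" and X: "X = ae_eq `` {h}"
      using X by (auto simp: WL_def quotient_def)
    obtain h' where [measurable]: "h' \<in> borel_measurable borel" and h': "AE x in lborel. h x = h' x"
      using lebesgue_ex_borel[OF h(1)] .
    have "rho P Q (enorm h') < top"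
      using h(2) WL_norm_eq_amalgam[OF pos _ h'] by (simp add: eq rho_def)
    then obtain f g where f: "kernel f" and [measurable]: "g \<in> borel_measurable borel"
      and g: "rho P Q (enorm g) < top" and fg: "AE x in lborel. cconv f g x = h' x"
      using M.factorization[of h'] by auto
    note [measurable] = kernelD(1)[OF f]
    have "f \<in> \<Union>(WL 1 r)"
      unfolding WL1 using WL_norm_eq_amalgam[of 1 R f f] amalgam_kernel_less_top[OF f R(1)] R
      by (simp add: measurable_completion)
    moreover have "g \<in> \<Union>(WL p q)"
      unfolding WL using WL_norm_eq_amalgam[OF pos, of g g] g
      by (simp add: eq rho_def measurable_completion)
    moreover have "conv f g = cconv f g"
      by (rule conv_eq_cconv) auto
    moreover from fg h' have "AE x in lborel. h x = cconv f g x"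
      by eventually_elim simp
    then have "(h, cconv f g) \<in> ae_eq"
      using h(1) by (simp add: ae_eq_def AE_completion measurable_completion)
    then have "X = ae_eq `` {cconv f g}"
      unfolding X by (rule equiv_class_eq[OF equiv_ae_eq])
    ultimately show ?thesis
      unfolding conv_set_def by force
  qed
  ultimately show ?thesis using * by blast
qed

end
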